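(* The generic 2-dimensional partial order has finite big Ramsey degrees.
   Context: Big Ramsey degrees: for structures $\mathcal{A}$, $\mathcal{C}$ over the same relational language, let $\mathrm{Emb}(\mathcal{A},\mathcal{C})$ be the set of embeddings (injective maps preserving and reflecting all relations). $T(\mathcal{A},\mathcal{C})$ is the least positive integer $t$ such that for every positive integer $k$ and every coloring $\chi : \mathrm{Emb}(\mathcal{A},\mathcal{C}) \to \{0,\ldots,k-1\}$ there is a $w \in \mathrm{Emb}(\mathcal{C},\mathcal{C})$ with $|\chi(w \circ \mathrm{Emb}(\mathcal{A},\mathcal{C}))| \le t$; if no such $t$ exists, $T(\mathcal{A},\mathcal{C}) = \infty$. $\mathcal{C}$ has finite big Ramsey degrees if $T(\mathcal{A},\mathcal{C}) < \infty$ for every finite substructure $\mathcal{A}$ of $\mathcal{C}$. A finite poset $(P,\preccurlyeq)$ is at most 2-dimensional if there are linear orders $\le_1, \le_2$ on $P$ with $\preccurlyeq\ =\ \le_1 \cap \le_2$. Let $\mathbf{K}_{\le 2}$ be the class of all finite at most 2-dimensional posets. The age $\mathrm{Age}(\mathcal{S})$ of a countable structure $\mathcal{S}$ is the class of all finite structures that embed into $\mathcal{S}$. The generic 2-dimensional partial order is the weak Fraïssé limit of $\mathbf{K}_{\le 2}$: the unique (up to isomorphism) countable structure $\Omega$ on $\omega$ with $\mathrm{Age}(\Omega) = \mathbf{K}_{\le 2}$ whose isomorphism class is comeager in the natural Baire space of all structures on $\omega$ with age $\mathbf{K}_{\le 2}$. Known criterion (Kubiś): a countable structure $\Omega$ with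 $\mathrm{Age}(\Omega) = \mathbf{K}_{\le 2}$ is the weak Fraïssé limit of $\mathbf{K}_{\le 2}$ provided it is weakly injective, i.e., for every $\mathcal{A} \in \mathbf{K}_{\le 2}$ and every embedding $f : \mathcal{A} \hookrightarrow \Omega$ there are $\overline{\mathcal{A}} \in \mathbf{K}_{\le 2}$ and an embedding $e : \mathcal{A} \hookrightarrow \overline{\mathcal{A}}$ such that for every $\mathcal{B} \in \mathbf{K}_{\le 2}$ and every embedding $g : \overline{\mathcal{A}} \hookrightarrow \mathcal{B}$ there is an embedding $h : \mathcal{B} \hookrightarrow \Omega$ with $h \circ g \circ e = f$. *)

theory Defs
  imports "HOL-Analysis.Analysis" "HOL-Library.Extended_Nat"
begin

section \<open>Binary relational structures, embeddings, big Ramsey degrees\<close>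

text \<open>Structures over the language of posets, i.e. one binary relation symbol.\<close>

datatype 'a binstr = Binstr (univ: "'a set") (rel: "('a \<times> 'a) set")

definition wf_binstr :: "'a binstr \<Rightarrow> bool" where
  "wf_binstr A \<longleftrightarrow> rel A \<subseteq> univ A \<times> univ A"

text \<open>Embeddings are extensional (\<open>undefined\<close> off the universe of the source). Otherwise
  a colouring of \<open>Emb A C\<close> could separate functions that agree on the universe of \<open>A\<close>.\<close>

definition Emb :: "'a binstr \<Rightarrow> 'b binstr \<Rightarrow> ('a \<Rightarrow> 'b) set" where
  "Emb A C = {f \<in> univ A \<rightarrow>\<^sub>E univ C. inj_on f (univ A) \<and>
     (\<forall>x\<in>univ A. \<forall>y\<in>univ A. (x, y) \<in> rel A \<longleftrightarrow> (f x, f y) \<in> rel C)}"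

definition isomorphic :: "'a binstr \<Rightarrow> 'b binstr \<Rightarrow> bool" where
  "isomorphic A B \<longleftrightarrow> (\<exists>f\<in>Emb A B. bij_betw f (univ A) (univ B))"

definition ramsey_bound :: "'a binstr \<Rightarrow> 'b binstr \<Rightarrow> nat \<Rightarrow> bool" where
  "ramsey_bound A C t \<longleftrightarrow> (\<forall>k>0. \<forall>c \<in> Emb A C \<rightarrow> {0..<k::nat}.
     \<exists>w\<in>Emb C C. card (c ` (compose (univ A) w ` Emb A C)) \<le> t)"

definition big_ramsey_degree :: "'a binstr \<Rightarrow> 'b binstr \<Rightarrow> enat" where
  "big_ramsey_degree A C =
     (if \<exists>t>0. ramsey_bound A C t then enat (LEAST t. t > 0 \<and> ramsey_bound A C t) else \<infinity>)"

definition induced :: "'a binstr \<Rightarrow> 'a set \<Rightarrow> 'a binstr" where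
  "induced C S = Binstr S (rel C \<inter> S \<times> S)"

definition finite_big_ramsey_degrees :: "'a binstr \<Rightarrow> bool" where
  "finite_big_ramsey_degrees C \<longleftrightarrow>
     (\<forall>S \<subseteq> univ C. finite S \<longrightarrow> big_ramsey_degree (induced C S) C < \<infinity>)"

section \<open>Ages and the class of finite at most 2-dimensional posets\<close>

text \<open>Isomorphism-closed classes of finite structures are represented by their members with
  universe contained in \<open>\<nat>\<close>; every finite structure is isomorphic to one of these.\<close>

definition Age :: "'a binstr \<Rightarrow> nat binstr set" where
  "Age S = {A. wf_binstr A \<and> finite (univ A) \<and> Emb A S \<noteq> {}}"

definition at_most_2_dim :: "'a binstr \<Rightarrow> bool" where
  "at_most_2_dim P \<longleftrightarrow> partial_order_on (univ P) (rel P) \<and>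
     (\<exists>l1 l2. linear_order_on (univ P) l1 \<and> linear_order_on (univ P) l2 \<and> rel P = l1 \<inter> l2)"

definition K2 :: "nat binstr set" where
  "K2 = {P. finite (univ P) \<and> at_most_2_dim P}"

section \<open>Comeager sets and weak Fraisse limits\<close>

definition nowhere_dense_in :: "'a topology \<Rightarrow> 'a set \<Rightarrow> bool" where
  "nowhere_dense_in X S \<longleftrightarrow> S \<subseteq> topspace X \<and> X interior_of (X closure_of S) = {}"

definition meager_in :: "'a topology \<Rightarrow> 'a set \<Rightarrow> bool" where
  "meager_in X S \<longleftrightarrow> (\<exists>\<N>. countable \<N> \<and> (\<forall>N\<in>\<N>. nowhere_dense_in X N) \<and> S = \<Union>\<N>)"

definition comeager_in :: "'a topology \<Rightarrow> 'a set \<Rightarrow> bool" where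
  "comeager_in X S \<longleftrightarrow> S \<subseteq> topspace X \<and> meager_in X (topspace X - S)"

text \<open>The space of all structures on \<open>\<omega>\<close> with age \<open>\<K>\<close>, as a subspace of \<open>2\<close> to the power
  \<open>\<omega> \<times> \<omega>\<close> with discrete \<open>2\<close>, via the characteristic function of the relation.\<close>

definition structure_space :: "nat binstr set \<Rightarrow> nat binstr topology" where
  "structure_space \<K> =
     pullback_topology {M. wf_binstr M \<and> univ M = UNIV \<and> Age M = \<K>} (\<lambda>M p. p \<in> rel M)
       (product_topology (\<lambda>_. discrete_topology (UNIV :: bool set)) UNIV)"

definition weak_Fraisse_limit :: "nat binstr set \<Rightarrow> nat binstr \<Rightarrow> bool" where
  "weak_Fraisse_limit \<K> \<Omega> \<longleftrightarrow> \<Omega> \<in> topspace (structure_space \<K>) \<and>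
     comeager_in (structure_space \<K>) {M \<in> topspace (structure_space \<K>). isomorphic M \<Omega>}"

definition generic_2_dim_partial_order :: "nat binstr \<Rightarrow> bool" where
  "generic_2_dim_partial_order \<Omega> \<longleftrightarrow> weak_Fraisse_limit K2 \<Omega>"

end

theory Submission
  imports Defs "HOL-Library.List_Lexorder"
begin

text \<open>
  Finiteness of big Ramsey degrees only depends on a structure up to bi-embeddability, so \<open>\<Omega>\<close>
  may be replaced by a concrete countable structure: the set of words over \<open>{0,1} \<times> {0,1}\<close> with the
  product of the two lexicographic orders of the coordinate projections. Substitution into
  an infinite parameter word is a self-embedding of this structure. An \<open>n\<close>-tuple of words is the
  image of one of finitely many tuples of short words under a finite parameter word, one
  parameter for each column of letters that occurs in the tuple. Hence the Ramsey theorem for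
  parameter words (every finite colouring of the \<open>k\<close>-parameter words is constant on those in the range of
  some infinite parameter word) bounds the number of colours. That theorem is obtained by induction on
  \<open>k\<close> with a fusion argument from the Carlson--Simpson theorem, whose proof uses a minimal
  idempotent in the semigroup of ultrafilters on words.

  Every countable poset whose finite subposets are at most 2-dimensional embeds into the words. For
  the converse embedding, a structure avoiding the given nowhere dense sets and containing a copy of the
  words is built from finite approximations. As \<open>K2\<close> fails amalgamation, each approximation of the copy
  carries extra points that determine its realizer up to swapping the two linear orders.
\<close>

section \<open>Ultrafilters as Boolean homomorphisms\<close>

text \<open>The Ramsey half rests on two facts. A lexicographic comparison is decided at the first
  difference, which substitution into a parameter word preserves; and \<open>n\<close> words over
  \<open>s\<close> letters, padded by an end marker, have at most \<open>(s+1)^n\<close> different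
  columns, however long they are.

  The obstacle in the other half is that a finite poset may have many realizers. Avoiding a nowhere
  dense set prolongs an approximation in an uncontrolled way, and the realizers of the result might
  order the part of the copy built so far differently from the words, leaving no room for the next
  word. The remedy is a forcing: if \<open>a\<close> is incomparable to \<open>b\<close> and to
  \<open>c\<close>, while \<open>b\<close> and \<open>c\<close> are comparable, then each linear
  order of a realizer puts \<open>a\<close> on the same side of both. A suitable set of extra points
  links every incomparable pair of the copy to one fixed pair of corners, so that only the naming of
  the two linear orders stays free.\<close>

lemma compact_bool_functions: "compact (UNIV :: ('i \<Rightarrow> bool) set)"
proof -
  have "compact_space (product_topology (\<lambda>_::'i. euclidean :: bool topology) UNIV)"
    unfolding compact_space_product_topology by (auto simp: compact_space_def intro: finite_imp_compact)
  then show ?thesis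
    by (metis compact_space_def compactin_euclidean_iff euclidean_product_topology topspace_euclidean)
qed

lemma closed_imp_compact_bool_functions: "closed K \<Longrightarrow> compact (K :: ('i \<Rightarrow> bool) set)"
  using compact_Int_closed[OF compact_bool_functions] by fastforce

lemma compact_imp_closed_bool_functions: "compact K \<Longrightarrow> closed (K :: ('i \<Rightarrow> bool) set)"
proof -
  assume K: "compact K"
  have "Hausdorff_space (product_topology (\<lambda>_::'i. euclidean :: bool topology) UNIV)"
    unfolding Hausdorff_space_product_topology
    by (simp add: Hausdorff_space_def disjnt_def) (metis hausdorff)
  then have "Hausdorff_space (euclidean :: ('i \<Rightarrow> bool) topology)"
    by (simp add: euclidean_product_topology)
  then show "closed K"
    using K by (metis closed_closedin compactin_euclidean_iff compactin_imp_closedin)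
qed

lemma continuous_eval: "continuous_on UNIV (\<lambda>p :: 'i \<Rightarrow> bool. p i)"
  by (rule continuous_on_product_coordinates)

text \<open>A condition on finitely many coordinates is closed; the laws that define an ultrafilter
  are intersections of such conditions.\<close>

lemma closed_eval_pred2: "closed {p :: 'i \<Rightarrow> bool. h (p i) (p j)}"
proof -
  have "{p. h (p i) (p j)} = ((\<lambda>p. p i) -` {True} \<inter> (\<lambda>p. p j) -` {b. h True b}) \<union>
    ((\<lambda>p. p i) -` {False} \<inter> (\<lambda>p. p j) -` {b. h False b})"
    (is "?A = ?B")
  proof (rule set_eqI)
    fix p show "p \<in> ?A \<longleftrightarrow> p \<in> ?B" by (cases "p i") auto
  qed
  moreover have "closed ((\<lambda>p :: 'i \<Rightarrow> bool. p i) -` A)" for i and A :: "bool set"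
    by (rule closed_vimage[OF finite_imp_closed continuous_eval]) simp
  ultimately show ?thesis by (simp only: closed_Int closed_Un)
qed

lemma closed_eval_pred3: "closed {p :: 'i \<Rightarrow> bool. h (p i) (p j) (p k)}"
proof -
  have "{p. h (p i) (p j) (p k)} = ({p. p k} \<inter> {p. h (p i) (p j) True}) \<union> ({p. \<not> p k} \<inter> {p. h (p i) (p j) False})"
    (is "?A = ?B")
  proof (rule set_eqI)
    fix p show "p \<in> ?A \<longleftrightarrow> p \<in> ?B" by (cases "p k") auto
  qed
  moreover have "closed {p :: 'i \<Rightarrow> bool. p k}" using closed_eval_pred2[of "\<lambda>a b. a" k k] by simp
  moreover have "closed {p :: 'i \<Rightarrow> bool. \<not> p k}" using closed_eval_pred2[of "\<lambda>a b. \<not> a" k k] by simp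
  moreover have "closed {p :: 'i \<Rightarrow> bool. h (p i) (p j) True}" "closed {p :: 'i \<Rightarrow> bool. h (p i) (p j) False}"
    using closed_eval_pred2[of "\<lambda>a b. h a b True" i j] closed_eval_pred2[of "\<lambda>a b. h a b False" i j] by auto
  ultimately show ?thesis by (simp only: closed_Int closed_Un)
qed

text \<open>Zorn's lemma, with compactness keeping the intersection of a chain nonempty.
  \<open>Q\<close> is a parameter because the lemma serves both closed subsemigroups and closed left
  ideals.\<close>

lemma minimal_closed_subset:
  fixes K :: "('i \<Rightarrow> bool) set"
  assumes "closed K" "K \<noteq> {}" "Q K"
    and inter: "\<And>C. C \<noteq> {} \<Longrightarrow> (\<And>L. L \<in> C \<Longrightarrow> Q L) \<Longrightarrow> Q (\<Inter>C)"
  obtains L where "L \<subseteq> K" "closed L" "L \<noteq> {}" "Q L"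
    "\<And>L'. \<lbrakk>L' \<subseteq> L; closed L'; L' \<noteq> {}; Q L'\<rbrakk> \<Longrightarrow> L' = L"
proof -
  define F where "F = {L. L \<subseteq> K \<and> closed L \<and> L \<noteq> {} \<and> Q L}"
  \<comment> \<open>Complements turn the minimal set that is sought into a maximal one.\<close>
  define S where "S = (\<lambda>L. - L) ` F"
  have "S \<noteq> {}" using assms by (auto simp: S_def F_def)
  then have "\<exists>M\<in>S. \<forall>X\<in>S. M \<subseteq> X \<longrightarrow> X = M"
  proof (rule subset_Zorn_nonempty)
    fix C assume C: "C \<noteq> {}" "subset.chain S C"
    define E where "E = (\<lambda>L. - L) ` C"
    have EF: "E \<subseteq> F" using C by (auto simp: E_def S_def subset.chain_def)
    have E0: "E \<noteq> {}" using C by (auto simp: E_def)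
    have ch: "L \<subseteq> L' \<or> L' \<subseteq> L" if "L \<in> E" "L' \<in> E" for L L'
    proof -
      obtain X X' where "X \<in> C" "X' \<in> C" "L = - X" "L' = - X'" using \<open>L \<in> E\<close> \<open>L' \<in> E\<close> unfolding E_def by blast
      moreover from this have "X \<subseteq> X' \<or> X' \<subseteq> X" using C(2) unfolding subset_chain_def by blast
      ultimately show ?thesis by auto
    qed
    have "\<Inter>E \<noteq> {}"
    proof
      assume "\<Inter>E = {}"
      moreover have "\<And>L. L \<in> E \<Longrightarrow> closed L" using EF by (auto simp: F_def)
      ultimately obtain E' where E': "finite E'" "E' \<subseteq> E" "UNIV \<inter> \<Inter>E' = {}"
        using compact_imp_fip[OF compact_bool_functions, of E] by (metis inf_top_left)
      have "\<exists>L\<in>E. L \<subseteq> \<Inter>E''" if "finite E''" "E'' \<subseteq> E" for E''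
        using that
      proof (induction E'')
        case empty then show ?case using E0 by auto
      next
        case (insert X E'')
        then obtain L where "L \<in> E" "L \<subseteq> \<Inter>E''" by auto
        then show ?case using ch[of L X] insert.prems by auto
      qed
      from this[OF E'(1,2)] obtain L where L: "L \<in> E" "L \<subseteq> \<Inter>E'" by (rule bexE)
      then have "L = {}" using E'(3) by simp
      then show False using L(1) EF by (auto simp: F_def)
    qed
    then have "\<Inter>E \<in> F"
      using EF E0 by (auto simp: F_def intro!: closed_Inter inter)
    moreover have "\<Union>C = - \<Inter>E" by (auto simp: E_def)
    ultimately show "\<Union>C \<in> S" by (auto simp: S_def)
  qed
  then obtain L where L: "L \<in> F" "\<And>X. X \<in> F \<Longrightarrow> - L \<subseteq> - X \<Longrightarrow> - X = - L"
    unfolding S_def by (elim bexE imageE) auto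
  show ?thesis
  proof (rule that[of L])
    fix L' assume "L' \<subseteq> L" "closed L'" "L' \<noteq> {}" "Q L'"
    then show "L' = L" using L(1) L(2)[of L'] by (auto simp: F_def)
  qed (use L in \<open>auto simp: F_def\<close>)
qed

text \<open>The Ellis-Numakura lemma. For \<open>e\<close> in a minimal closed subsemigroup
  \<open>L\<close>, the set \<open>L e\<close> is a closed subsemigroup, hence all of
  \<open>L\<close>. So the \<open>p\<close> in \<open>L\<close> with \<open>m p e = e\<close> form a
  nonempty closed subsemigroup, hence again all of \<open>L\<close>, and \<open>e\<close> is among
  them.\<close>

lemma idempotent_exists:
  fixes K :: "('i \<Rightarrow> bool) set" and m :: "('i \<Rightarrow> bool) \<Rightarrow> ('i \<Rightarrow> bool) \<Rightarrow> 'i \<Rightarrow> bool"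
  assumes K: "closed K" "K \<noteq> {}"
    and clos: "\<And>p q. p \<in> K \<Longrightarrow> q \<in> K \<Longrightarrow> m p q \<in> K"
    and assoc: "\<And>p q r. m (m p q) r = m p (m q r)"
    and cont: "\<And>q. continuous_on UNIV (\<lambda>p. m p q)"
  obtains e where "e \<in> K" "m e e = e"
proof -
  define Q where "Q L \<longleftrightarrow> (\<forall>p\<in>L. \<forall>q\<in>L. m p q \<in> L)" for L
  obtain L where L: "L \<subseteq> K" "closed L" "L \<noteq> {}" "Q L"
    and min: "\<And>L'. \<lbrakk>L' \<subseteq> L; closed L'; L' \<noteq> {}; Q L'\<rbrakk> \<Longrightarrow> L' = L"
    by (rule minimal_closed_subset[of K Q]) (use assms in \<open>auto simp: Q_def\<close>)
  obtain e where e: "e \<in> L" using L by auto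
  have cl: "closed ((\<lambda>p. m p e) ` L)"
    by (rule compact_imp_closed_bool_functions, rule compact_continuous_image)
      (use L closed_imp_compact_bool_functions continuous_on_subset[OF cont] in auto)
  have 1: "(\<lambda>p. m p e) ` L = L"
  proof (rule min[OF _ cl])
    show "(\<lambda>p. m p e) ` L \<subseteq> L" using L e by (auto simp: Q_def)
    show "(\<lambda>p. m p e) ` L \<noteq> {}" using e by auto
    show "Q ((\<lambda>p. m p e) ` L)"
      unfolding Q_def
    proof (intro ballI, elim imageE)
      fix p q p' q' assume pq: "p' \<in> L" "q' \<in> L" "p = m p' e" "q = m q' e"
      have "p \<in> L" using L(4) e pq(1) unfolding pq Q_def by simp
      then have "m p q' \<in> L" using L(4) pq(2) unfolding Q_def by simp
      moreover have "m p q = m (m p q') e" unfolding pq(4) by (simp only: assoc)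
      ultimately show "m p q \<in> (\<lambda>p. m p e) ` L" by (metis image_eqI)
    qed
  qed
  have "closed {p. m p e = e}"
  proof -
    have "{p. m p e = e} = (\<lambda>p. m p e) -` {e}" by auto
    moreover have "closed {e}" by (intro compact_imp_closed_bool_functions) auto
    ultimately show ?thesis using cont
      by (simp add: closed_vimage)
  qed
  moreover have "{p \<in> L. m p e = e} = L \<inter> {p. m p e = e}" by auto
  ultimately have "closed {p \<in> L. m p e = e}" using L by (simp add: closed_Int)
  moreover have "{p \<in> L. m p e = e} \<noteq> {}"
  proof -
    have "e \<in> (\<lambda>p. m p e) ` L" using 1 e by simp
    then show ?thesis by auto
  qed
  moreover have "Q {p \<in> L. m p e = e}" using L by (auto simp: Q_def assoc)
  ultimately have "{p \<in> L. m p e = e} = L" by (intro min) auto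
  then have "m e e = e" using e by auto
  then show ?thesis using that e L by auto
qed

text \<open>As a function from predicates to \<open>bool\<close>, an ultrafilter is a point of a
  compact space. The carrier \<open>S\<close> is a member of the ultrafilter instead of a type, so
  ultrafilters on different sets of words live in one space and can be multiplied.\<close>

definition ultrafilter_on :: "'a set \<Rightarrow> (('a \<Rightarrow> bool) \<Rightarrow> bool) \<Rightarrow> bool" where
  "ultrafilter_on S p \<longleftrightarrow> p (\<lambda>x. x \<in> S) \<and> (\<forall>P. p (\<lambda>x. \<not> P x) = (\<not> p P)) \<and>
     (\<forall>P Q. p (\<lambda>x. P x \<and> Q x) = (p P \<and> p Q))"

lemma ultrafilter_on_not: "ultrafilter_on S p \<Longrightarrow> p (\<lambda>x. \<not> P x) = (\<not> p P)"
  and ultrafilter_on_conj: "ultrafilter_on S p \<Longrightarrow> p (\<lambda>x. P x \<and> Q x) = (p P \<and> p Q)"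
  and ultrafilter_on_carrier: "ultrafilter_on S p \<Longrightarrow> p (\<lambda>x. x \<in> S)"
  by (simp_all add: ultrafilter_on_def)

lemma ultrafilter_on_disj: 
  assumes "ultrafilter_on S p" shows "p (\<lambda>x. P x \<or> Q x) = (p P \<or> p Q)"
proof -
  have "p (\<lambda>x. \<not> (\<not> P x \<and> \<not> Q x)) = (\<not> (\<not> p P \<and> \<not> p Q))"
    by (simp only: ultrafilter_on_not[OF assms] ultrafilter_on_conj[OF assms])
  then show ?thesis by simp
qed

lemma ultrafilter_on_mono:
  assumes "ultrafilter_on S p" "p P" "\<And>x. x \<in> S \<Longrightarrow> P x \<Longrightarrow> Q x"
  shows "p Q"
proof -
  have "p (\<lambda>x. (x \<in> S \<and> P x) \<and> Q x)"
  proof -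
    have "(\<lambda>x. (x \<in> S \<and> P x) \<and> Q x) = (\<lambda>x. x \<in> S \<and> P x)" using assms(3) by auto
    then show ?thesis using assms(1,2) by (simp add: ultrafilter_on_def)
  qed
  then show ?thesis using assms(1) by (simp add: ultrafilter_on_def)
qed

lemma ultrafilter_on_ball:
  assumes "ultrafilter_on S p" "finite A" "\<And>a. a \<in> A \<Longrightarrow> p (P a)"
  shows "p (\<lambda>x. \<forall>a\<in>A. P a x)"
  using assms(2,3)
proof (induction A)
  case empty
  then show ?case using ultrafilter_on_mono[OF assms(1) ultrafilter_on_carrier[OF assms(1)]] by auto
next
  case (insert a A)
  then show ?case using ultrafilter_on_conj[OF assms(1), of "P a" "\<lambda>x. \<forall>a\<in>A. P a x"] by auto
qed

lemma ultrafilter_on_ex: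
  assumes "ultrafilter_on S p" "p P"
  obtains x where "x \<in> S" "P x"
proof -
  have "\<exists>x\<in>S. P x"
  proof (rule ccontr)
    assume "\<not> (\<exists>x\<in>S. P x)"
    then have "p (\<lambda>x. \<not> P x)"
      using ultrafilter_on_mono[OF assms(1) ultrafilter_on_carrier[OF assms(1)]] by auto
    then show False using assms by (simp add: ultrafilter_on_def)
  qed
  then show ?thesis using that by auto
qed

lemma ultrafilter_on_color:
  assumes "ultrafilter_on S p" "finite (c ` S)"
  obtains i where "p (\<lambda>x. c x = i)"
proof -
  have "\<exists>i. p (\<lambda>x. c x = i)"
  proof (rule ccontr)
    assume "\<not> ?thesis"
    then have "p (\<lambda>x. \<forall>i\<in>c ` S. c x \<noteq> i)"
      by (intro ultrafilter_on_ball[OF assms]) (auto simp: ultrafilter_on_not[OF assms(1)])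
    then obtain x where "x \<in> S" "\<forall>i\<in>c ` S. c x \<noteq> i" by (rule ultrafilter_on_ex[OF assms(1)])
    then show False by auto
  qed
  then show ?thesis using that by auto
qed

lemma ultrafilter_on_principal: "x \<in> S \<Longrightarrow> ultrafilter_on S (\<lambda>P. P x)"
  by (simp add: ultrafilter_on_def)

lemma closed_ultrafilters: "closed {p. ultrafilter_on S p}"
proof -
  have "{p. ultrafilter_on S p} = {p. p (\<lambda>x. x \<in> S)} \<inter>
     ((\<Inter>P. {p. p (\<lambda>x. \<not> P x) = (\<not> p P)}) \<inter> (\<Inter>P. \<Inter>Q. {p. p (\<lambda>x. P x \<and> Q x) = (p P \<and> p Q)}))"
    by (auto simp: ultrafilter_on_def)
  moreover have "closed {p. p (\<lambda>x. x \<in> S)}"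
    using closed_eval_pred2[of "\<lambda>a b. a" "\<lambda>x. x \<in> S" "\<lambda>x. x \<in> S"] by simp
  moreover have "closed {p. p (\<lambda>x. \<not> P x) = (\<not> p P)}" for P :: "'a \<Rightarrow> bool"
    using closed_eval_pred2[of "\<lambda>a b. a = (\<not> b)" "\<lambda>x. \<not> P x" P] by simp
  moreover have "closed {p. p (\<lambda>x. P x \<and> Q x) = (p P \<and> p Q)}" for P Q :: "'a \<Rightarrow> bool"
    using closed_eval_pred3[of "\<lambda>a b c. a = (b \<and> c)" "\<lambda>x. P x \<and> Q x" P Q] by simp
  ultimately show ?thesis by (simp only:) (intro closed_Int closed_INT ballI)
qed

text \<open>Finitely many of these closed sets share the principal ultrafilter at a large number, so
  all of them meet by compactness. Such a \<open>p\<close> ignores finite initial segments and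
  serves to take limits.\<close>

lemma nonprincipal_ultrafilter:
  "\<exists>p. \<forall>n::nat. ultrafilter_on {n..} p"
proof -
  have "\<Inter>(range (\<lambda>n::nat. {p. ultrafilter_on {n..} p})) \<noteq> {}"
  proof
    assume "\<Inter>(range (\<lambda>n::nat. {p. ultrafilter_on {n..} p})) = {}"
    moreover have "\<And>T. T \<in> range (\<lambda>n::nat. {p. ultrafilter_on {n..} p}) \<Longrightarrow> closed T"
      by (auto simp: closed_ultrafilters)
    ultimately obtain E where E: "finite E" "E \<subseteq> range (\<lambda>n::nat. {p. ultrafilter_on {n..} p})" "\<Inter>E = {}"
      using compact_imp_fip[OF compact_bool_functions, of "range (\<lambda>n::nat. {p. ultrafilter_on {n..} p})"]
      by (metis inf_top_left)
    then obtain N where N: "finite N" "E = (\<lambda>n::nat. {p. ultrafilter_on {n..} p}) ` N"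
      by (meson finite_subset_image)
    obtain k where k: "\<forall>n\<in>N. n \<le> k" using N(1) finite_nat_set_iff_bounded_le by blast
    then have "(\<lambda>P. P k) \<in> \<Inter>E" unfolding N by (auto intro: ultrafilter_on_principal)
    then show False using E by auto
  qed
  then obtain p where p: "p \<in> \<Inter>(range (\<lambda>n::nat. {p. ultrafilter_on {n..} p}))" unfolding ex_in_conv[symmetric] by (rule exE)
  have "\<forall>n. ultrafilter_on {n..} p" using p by simp
  then show ?thesis by (rule exI[of _ p])
qed

section \<open>Parameter words and the Carlson--Simpson theorem\<close>

text \<open>Letters below \<open>s\<close> are constants, and the letter \<open>s + j\<close> is the \<open>j\<close>-th parameter.\<close>

definition subst_word :: "nat \<Rightarrow> nat list \<Rightarrow> nat list \<Rightarrow> nat list" where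
  "subst_word s x l = map (\<lambda>c. if c < s then c else x ! (c - s)) l"

lemma subst_word_simps [simp]:
  "subst_word s x [] = []" "subst_word s x (l @ l') = subst_word s x l @ subst_word s x l'"
  "subst_word s x (c # l) = (if c < s then c else x ! (c - s)) # subst_word s x l" "length (subst_word s x l) = length l"
  by (simp_all add: subst_word_def)

lemma subst_word_cong:
  assumes "\<And>c. c \<in> set l \<Longrightarrow> s \<le> c \<Longrightarrow> x ! (c - s) = y ! (c - s)"
  shows "subst_word s x l = subst_word s y l"
  using assms by (auto simp: subst_word_def)

lemma subst_word_subst_word:
  assumes "set l \<subseteq> {..<s + length y}"
  shows "subst_word s x (subst_word s y l) = subst_word s (subst_word s x y) l"
  using assms by (auto simp: subst_word_def subset_iff)

lemma subst_word_extend: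
  assumes "set l \<subseteq> {..<s + length x}"
  shows "subst_word s (x @ z) l = subst_word s x l"
  using assms by (intro subst_word_cong) (auto simp: nth_append subset_iff less_diff_conv2)

lemma subst_word_const: "set l \<subseteq> {..<s} \<Longrightarrow> subst_word s x l = l"
  by (auto simp: subst_word_def subset_iff intro!: map_idI)

lemma set_subst_word:
  assumes "set l \<subseteq> {..<s + length x}" "set x \<subseteq> A" "{..<s} \<subseteq> A"
  shows "set (subst_word s x l) \<subseteq> A"
proof
  fix d assume "d \<in> set (subst_word s x l)"
  then obtain c where c: "c \<in> set l" "d = (if c < s then c else x ! (c - s))"
    by (auto simp: subst_word_def)
  show "d \<in> A"
  proof (cases "c < s")
    case True
    then show ?thesis using c assms by auto
  next
    case False
    then have "c - s < length x" using c assms(1) by (auto simp: subset_iff)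
    then show ?thesis using c False assms(2) nth_mem by fastforce
  qed
qed

lemma subst_word_upt: "set l \<subseteq> {..<s + n} \<Longrightarrow> subst_word s [s..<s + n] l = l"
  by (auto simp: subst_word_def subset_iff intro!: map_idI)

text \<open>An infinite parameter word is given by its prefixes: \<open>G m\<close> ends right before the first
  occurrence of the \<open>m\<close>-th parameter. So \<open>apply_word s G x\<close> is the substitution of a finite word \<open>x\<close>,
  truncated where the letters of \<open>x\<close> are used up.\<close>

definition param_space :: "nat \<Rightarrow> (nat \<Rightarrow> nat list) \<Rightarrow> bool" where
  "param_space s G \<longleftrightarrow> (\<forall>m. set (G m) \<subseteq> {..<s + m} \<and> (\<exists>z. G (Suc m) = G m @ (s + m) # z))"

definition apply_word :: "nat \<Rightarrow> (nat \<Rightarrow> nat list) \<Rightarrow> nat list \<Rightarrow> nat list" where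
  "apply_word s G x = subst_word s x (G (length x))"

definition comp_space :: "nat \<Rightarrow> (nat \<Rightarrow> nat list) \<Rightarrow> (nat \<Rightarrow> nat list) \<Rightarrow> nat \<Rightarrow> nat list" where
  "comp_space s G H m = apply_word s G (H m)"

lemma param_space_set: "param_space s G \<Longrightarrow> set (G m) \<subseteq> {..<s + m}"
  by (auto simp: param_space_def)

lemma param_space_prefix:
  assumes "param_space s G"
  shows "\<exists>z. G (m + Suc k) = G m @ (s + m) # z"
proof (induction k)
  case 0
  then show ?case using assms by (auto simp: param_space_def)
next
  case (Suc k)
  then obtain z where "G (m + Suc k) = G m @ (s + m) # z" by auto
  moreover obtain z' where "G (Suc (m + Suc k)) = G (m + Suc k) @ (s + (m + Suc k)) # z'"
    using assms unfolding param_space_def by blast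
  ultimately show ?case by simp
qed

text \<open>The letter \<open>a\<close> at position \<open>length x\<close> fills the parameter
  \<open>s + length x\<close>, whose first occurrence comes right after the prefix
  \<open>G (length x)\<close>. So images keep their prefixes and show the next letter; most later
  facts on substitution rest on this.\<close>

lemma apply_word_Cons:
  assumes "param_space s G"
  obtains z where "apply_word s G (x @ a # y) = apply_word s G x @ a # z"
proof -
  obtain z where z: "G (length x + Suc (length y)) = G (length x) @ (s + length x) # z"
    using param_space_prefix[OF assms] by blast
  have "subst_word s (x @ a # y) (G (length x)) = subst_word s x (G (length x))"
    by (rule subst_word_extend) (rule param_space_set[OF assms])
  then have "apply_word s G (x @ a # y) = apply_word s G x @ a # subst_word s (x @ a # y) z"
    using z by (simp add: apply_word_def nth_append)
  then show ?thesis by (rule that)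
qed

lemma set_apply_word:
  assumes "param_space s G" "set x \<subseteq> {..<n}" "s \<le> n"
  shows "set (apply_word s G x) \<subseteq> {..<n}"
  unfolding apply_word_def by (rule set_subst_word) (use assms param_space_set[OF assms(1)] in auto)

lemma subst_word_apply_word: "param_space s G \<Longrightarrow> subst_word s u (apply_word s G y) = apply_word s G (subst_word s u y)"
  unfolding apply_word_def by (simp add: subst_word_subst_word param_space_set)

lemma apply_word_comp_space: "param_space s G \<Longrightarrow> apply_word s (comp_space s G H) x = apply_word s G (apply_word s H x)"
  using subst_word_apply_word[of s G x "H (length x)"] by (simp add: comp_space_def apply_word_def)

lemma param_space_comp_space:
  assumes "param_space s G" "param_space s H"
  shows "param_space s (comp_space s G H)"
  unfolding param_space_def
proof (intro allI conjI)
  fix m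
  show "set (comp_space s G H m) \<subseteq> {..<s + m}"
    unfolding comp_space_def by (rule set_apply_word[OF assms(1) param_space_set[OF assms(2)]]) simp
  obtain z where z: "H (Suc m) = H m @ (s + m) # z" using assms(2) by (auto simp: param_space_def)
  obtain z' where "apply_word s G (H m @ (s + m) # z) = apply_word s G (H m) @ (s + m) # z'" using apply_word_Cons[OF assms(1)] .
  then show "\<exists>z. comp_space s G H (Suc m) = comp_space s G H m @ (s + m) # z"
    by (simp add: comp_space_def z)
qed

definition id_space :: "nat \<Rightarrow> nat \<Rightarrow> nat list" where
  "id_space s m = [s..<s + m]"

lemma param_space_id_space: "param_space s (id_space s)"
  by (auto simp: param_space_def id_space_def)

lemma apply_word_id_space: "apply_word s (id_space s) x = x"
  by (auto simp: apply_word_def id_space_def subst_word_def intro!: nth_equalityI)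

text \<open>The recursion splits a word at the first occurrence of its last parameter. Hence all
  \<open>k\<close> parameters occur, and their first occurrences are in increasing order.\<close>

fun param_word :: "nat \<Rightarrow> nat \<Rightarrow> nat list \<Rightarrow> bool" where
  "param_word s 0 y \<longleftrightarrow> set y \<subseteq> {..<s}"
| "param_word s (Suc k) y \<longleftrightarrow> (\<exists>y' z. y = y' @ (s + k) # z \<and> param_word s k y' \<and> set z \<subseteq> {..<s + Suc k})"

lemma param_word_set: "param_word s k y \<Longrightarrow> set y \<subseteq> {..<s + k}"
proof (induction k arbitrary: y)
  case (Suc k)
  then obtain y' z where "y = y' @ (s + k) # z" "param_word s k y'" "set z \<subseteq> {..<s + Suc k}" by auto
  then show ?case using Suc.IH[of y'] by fastforce
qed auto

lemma param_word_contains: "param_word s k y \<Longrightarrow> {s..<s + k} \<subseteq> set y"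
proof (induction k arbitrary: y)
  case (Suc k)
  then obtain y' z where "y = y' @ (s + k) # z" "param_word s k y'" by auto
  then show ?case using Suc.IH[of y'] by (auto simp: less_Suc_eq)
qed auto

lemma param_word_apply_word:
  assumes "param_space s G" "param_word s k y"
  shows "param_word s k (apply_word s G y)"
  using assms(2)
proof (induction k arbitrary: y)
  case 0
  then show ?case using set_apply_word[OF assms(1), of y s] by simp
next
  case (Suc k)
  then obtain y' z where y: "y = y' @ (s + k) # z" "param_word s k y'" by auto
  obtain z' where z': "apply_word s G y = apply_word s G y' @ (s + k) # z'" unfolding y(1) using apply_word_Cons[OF assms(1)] .
  have "set (apply_word s G y) \<subseteq> {..<s + Suc k}"
    by (rule set_apply_word[OF assms(1) param_word_set[OF Suc.prems]]) simp
  then show ?case using z' Suc.IH[OF y(2)] by auto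
qed

section \<open>The semigroup of ultrafilters on words\<close>

definition uf_mult :: "(('a list \<Rightarrow> bool) \<Rightarrow> bool) \<Rightarrow> (('a list \<Rightarrow> bool) \<Rightarrow> bool) \<Rightarrow> ('a list \<Rightarrow> bool) \<Rightarrow> bool" where
  "uf_mult p q = (\<lambda>P. p (\<lambda>w. q (\<lambda>u. P (w @ u))))"

definition uf_subst :: "nat \<Rightarrow> nat \<Rightarrow> ((nat list \<Rightarrow> bool) \<Rightarrow> bool) \<Rightarrow> (nat list \<Rightarrow> bool) \<Rightarrow> bool" where
  "uf_subst s a q = (\<lambda>P. q (\<lambda>u. P (subst_word s [a] u)))"

lemma uf_mult_assoc: "uf_mult (uf_mult p q) r = uf_mult p (uf_mult q r)"
  by (simp add: uf_mult_def)

lemma uf_subst_uf_mult: "uf_subst s a (uf_mult p q) = uf_mult (uf_subst s a p) (uf_subst s a q)"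
  by (simp add: uf_mult_def uf_subst_def)

text \<open>For fixed \<open>q\<close>, each coordinate of the product is a coordinate of
  \<open>p\<close>. Left translations need not be continuous, so the closed images taken below are
  all under right translations.\<close>

lemma continuous_uf_mult: "continuous_on UNIV (\<lambda>p. uf_mult p q)"
  by (rule continuous_on_coordinatewise_then_product) (simp add: uf_mult_def)

lemma ultrafilter_on_uf_mult:
  assumes p: "ultrafilter_on A p" and q: "ultrafilter_on B q"
    and "\<And>w u. w \<in> A \<Longrightarrow> u \<in> B \<Longrightarrow> w @ u \<in> C"
  shows "ultrafilter_on C (uf_mult p q)"
proof -
  have "q (\<lambda>u. w @ u \<in> C)" if "w \<in> A" for w
    using ultrafilter_on_mono[OF q ultrafilter_on_carrier[OF q]] assms(3) that by auto
  then have "p (\<lambda>w. q (\<lambda>u. w @ u \<in> C))"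
    using ultrafilter_on_mono[OF p ultrafilter_on_carrier[OF p]] by auto
  then show ?thesis unfolding ultrafilter_on_def uf_mult_def
    by (simp add: ultrafilter_on_not[OF p] ultrafilter_on_not[OF q] ultrafilter_on_conj[OF p] ultrafilter_on_conj[OF q])
qed

lemma ultrafilter_on_uf_subst:
  assumes q: "ultrafilter_on B q" and "\<And>u. u \<in> B \<Longrightarrow> subst_word s [a] u \<in> C"
  shows "ultrafilter_on C (uf_subst s a q)"
proof -
  have "q (\<lambda>u. subst_word s [a] u \<in> C)"
    using ultrafilter_on_mono[OF q ultrafilter_on_carrier[OF q]] assms(2) by auto
  then show ?thesis unfolding ultrafilter_on_def uf_subst_def
    by (simp add: ultrafilter_on_not[OF q] ultrafilter_on_conj[OF q])
qed

lemma ultrafilter_on_eqI: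
  assumes p: "ultrafilter_on A p" and "\<And>x. x \<in> A \<Longrightarrow> P x = Q x"
  shows "p P = p Q"
  using ultrafilter_on_mono[OF p, of P Q] ultrafilter_on_mono[OF p, of Q P] assms(2) by auto

lemma closed_uf_mult_image: "closed K \<Longrightarrow> closed ((\<lambda>p. uf_mult p q) ` K)"
  by (rule compact_imp_closed_bool_functions, rule compact_continuous_image)
    (auto intro: continuous_on_subset[OF continuous_uf_mult] closed_imp_compact_bool_functions)

text \<open>\<open>p\<close> is an idempotent in a minimal left ideal \<open>L\<close>, and \<open>q\<close> an idempotent ultrafilter on words
  starting with the variable \<open>s\<close> that is a left multiple of \<open>p\<close>. Every instance of \<open>q\<close> is then an
  idempotent of \<open>L\<close>, and idempotents of a minimal left ideal are right identities of it.\<close>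

lemma variable_word_ultrafilter:
  fixes s :: nat
  defines "S \<equiv> {w. set w \<subseteq> {..<s}}" and "VL \<equiv> {s # u | u. set u \<subseteq> {..<Suc s}}"
  obtains p q where "ultrafilter_on S p" "ultrafilter_on VL q"
    "\<And>a. a < s \<Longrightarrow> uf_mult p (uf_subst s a q) = p"
    "\<And>a b. a < s \<Longrightarrow> b < s \<Longrightarrow> uf_mult (uf_subst s a q) (uf_subst s b q) = uf_subst s a q"
proof -
  define B where "B = {p. ultrafilter_on S p}"
  have BB: "uf_mult p q \<in> B" if "p \<in> B" "q \<in> B" for p q
    using that by (auto simp: B_def S_def intro!: ultrafilter_on_uf_mult)
  have B0: "B \<noteq> {}" "closed B"
    using ultrafilter_on_principal[of "[]" S] closed_ultrafilters by (auto simp: B_def S_def)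
  define Q where "Q L \<longleftrightarrow> (\<forall>x\<in>B. \<forall>y\<in>L. uf_mult x y \<in> L)" for L
  obtain L where L: "L \<subseteq> B" "closed L" "L \<noteq> {}" "Q L"
    and min: "\<And>L'. \<lbrakk>L' \<subseteq> L; closed L'; L' \<noteq> {}; Q L'\<rbrakk> \<Longrightarrow> L' = L"
  proof (rule minimal_closed_subset[of B Q])
    show "Q B" using BB by (auto simp: Q_def)
    show "Q (\<Inter>C)" if "\<And>L. L \<in> C \<Longrightarrow> Q L" for C
      using that by (fastforce simp: Q_def)
  qed (use B0 in auto)
  \<comment> \<open>The left multiples of \<open>y\<close> form a closed left ideal inside
    \<open>L\<close>, which is all of \<open>L\<close> by minimality.\<close>
  have gen: "(\<lambda>x. uf_mult x y) ` B = L" if "y \<in> L" for y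
  proof (rule min)
    show "(\<lambda>x. uf_mult x y) ` B \<subseteq> L" using L(4) that by (auto simp: Q_def)
    show "closed ((\<lambda>x. uf_mult x y) ` B)" by (rule closed_uf_mult_image) (rule B0)
    show "(\<lambda>x. uf_mult x y) ` B \<noteq> {}" using B0 by simp
    show "Q ((\<lambda>x. uf_mult x y) ` B)"
      unfolding Q_def
    proof (intro ballI, elim imageE)
      fix x z z' assume "x \<in> B" "z' \<in> B" "z = uf_mult z' y"
      then show "uf_mult x z \<in> (\<lambda>x. uf_mult x y) ` B"
        using BB[of x z'] uf_mult_assoc[of x z' y] by (metis image_eqI)
    qed
  qed
  obtain p where p: "p \<in> L" "uf_mult p p = p"
    by (rule idempotent_exists[OF L(2,3) _ uf_mult_assoc continuous_uf_mult])
      (use L(1,4) in \<open>auto simp: Q_def\<close>)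
  have pB: "ultrafilter_on S p" using p(1) L(1) by (auto simp: B_def)
  define V where "V = {y. ultrafilter_on VL y}"
  have VB: "uf_mult y x \<in> V" if "y \<in> V" "x \<in> B" for x y
    using that unfolding V_def B_def
    by (auto simp: S_def VL_def subset_iff intro!: ultrafilter_on_uf_mult) (metis less_SucI)
  have VV: "uf_mult y x \<in> V" if "y \<in> V" "x \<in> V" for x y
    using that unfolding V_def
    by (auto simp: VL_def subset_iff intro!: ultrafilter_on_uf_mult)
  have V0: "V \<noteq> {}" "closed V"
    using ultrafilter_on_principal[of "[s]" VL] closed_ultrafilters by (auto simp: V_def VL_def)
  obtain q where q: "q \<in> (\<lambda>y. uf_mult y p) ` V" "uf_mult q q = q"
  proof (rule idempotent_exists[OF closed_uf_mult_image[OF V0(2), of p] _ _ uf_mult_assoc continuous_uf_mult])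
    show "(\<lambda>y. uf_mult y p) ` V \<noteq> {}" using V0 by simp
    show "uf_mult x y \<in> (\<lambda>y. uf_mult y p) ` V" if "x \<in> (\<lambda>y. uf_mult y p) ` V" "y \<in> (\<lambda>y. uf_mult y p) ` V" for x y
    proof -
      from that obtain x' y' where xy: "x' \<in> V" "y' \<in> V" "x = uf_mult x' p" "y = uf_mult y' p" by (elim imageE) 
      have "p \<in> B" using pB by (simp add: B_def)
      then have "uf_mult (uf_mult x' p) y' \<in> V" by (intro VV VB xy)
      moreover have "uf_mult x y = uf_mult (uf_mult (uf_mult x' p) y') p" by (simp add: xy uf_mult_assoc)
      ultimately show ?thesis by (metis image_eqI)
    qed
  qed
  obtain y where y: "y \<in> V" "q = uf_mult y p" using q(1) by blast
  have qV: "ultrafilter_on VL q" using VB[OF y(1), of p] y(2) pB by (auto simp: V_def B_def)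
  have usL: "uf_subst s a q \<in> L" if "a < s" for a
  proof -
    \<comment> \<open>\<open>p\<close> lives on words without the variable. So an instance of
      \<open>q = uf_mult y p\<close> changes \<open>y\<close> only and is still a left multiple of
      \<open>p\<close>, hence in \<open>L\<close>.\<close>
    have "uf_subst s a p = p"
    proof
      fix P show "uf_subst s a p P = p P"
        unfolding uf_subst_def by (rule ultrafilter_on_eqI[OF pB]) (simp add: S_def subst_word_const)
    qed
    then have "uf_subst s a q = uf_mult (uf_subst s a y) p" by (simp add: y(2) uf_subst_uf_mult)
    moreover have "uf_subst s a y \<in> B"
      using y(1) unfolding B_def V_def mem_Collect_eq
    proof (rule ultrafilter_on_uf_subst)
      fix u assume "u \<in> VL"
      then have "set u \<subseteq> {..<s + length [a]}" by (auto simp: VL_def)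
      then have "set (subst_word s [a] u) \<subseteq> {..<s}" by (rule set_subst_word) (use that in auto)
      then show "subst_word s [a] u \<in> S" by (simp add: S_def)
    qed
    ultimately show ?thesis using L(4) p(1) by (auto simp: Q_def)
  qed
  have idem: "uf_mult (uf_subst s a q) (uf_subst s a q) = uf_subst s a q" for a
    using q(2) by (metis uf_subst_uf_mult)
  have absorb: "uf_mult x (uf_subst s a q) = x" if a: "a < s" and x: "x \<in> L" for a x
  proof -
    have "x \<in> (\<lambda>z. uf_mult z (uf_subst s a q)) ` B" using gen[OF usL[OF a]] x by simp
    then obtain z where "x = uf_mult z (uf_subst s a q)" by (rule imageE)
    then show ?thesis by (simp add: uf_mult_assoc idem)
  qed
  show ?thesis
  proof (rule that[OF pB qV])
    show "uf_mult p (uf_subst s a q) = p" if "a < s" for a by (rule absorb[OF that p(1)])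
    show "uf_mult (uf_subst s a q) (uf_subst s b q) = uf_subst s a q" if "a < s" "b < s" for a b
      by (rule absorb[OF \<open>b < s\<close> usL[OF \<open>a < s\<close>]])
  qed
qed

text \<open>Write \<open>q_a\<close> for \<open>uf_subst s a q\<close>. The colour is the one
  selected by \<open>p\<close>, and a word is good if it has this colour and keeps it when any
  instance of a \<open>q\<close>-typical variable word is appended. The identity
  \<open>p q_a = p\<close> makes \<open>p\<close>-almost every word good, and
  \<open>q_a q_b = q_a\<close> keeps a good word good after such an appending (\<open>step\<close>).
  As \<open>q\<close> meets finitely many demands at once, one variable word serves all words built
  so far.\<close>

lemma carlson_simpson_words:
  fixes c :: "nat list \<Rightarrow> 'c"
  assumes "finite (c ` {y. set y \<subseteq> {..<s}})"
  obtains G i where "param_space s G" "\<And>y. set y \<subseteq> {..<s} \<Longrightarrow> c (apply_word s G y) = i"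
proof -
  define S where "S = {w. set w \<subseteq> {..<s}}"
  define VL where "VL = {s # u | u. set u \<subseteq> {..<Suc s}}"
  obtain p q where p: "ultrafilter_on S p" and q: "ultrafilter_on VL q"
    and pq: "\<And>a. a < s \<Longrightarrow> uf_mult p (uf_subst s a q) = p"
    and qq: "\<And>a b. a < s \<Longrightarrow> b < s \<Longrightarrow> uf_mult (uf_subst s a q) (uf_subst s b q) = uf_subst s a q"
    using variable_word_ultrafilter[of s] unfolding S_def VL_def by blast
  obtain i where i: "p (\<lambda>w. c w = i)" by (rule ultrafilter_on_color[OF p]) (use assms in \<open>simp add: S_def\<close>)
  define P where "P w \<longleftrightarrow> c w = i" for w
  define good where "good w \<longleftrightarrow> P w \<and> (\<forall>a\<in>{..<s}. q (\<lambda>u. P (w @ subst_word s [a] u)))" for w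
  have "p good"
  proof -
    have "p (\<lambda>w. q (\<lambda>u. P (w @ subst_word s [a] u)))" if "a < s" for a
      using fun_cong[OF pq[OF that], of P] i unfolding uf_mult_def uf_subst_def P_def by simp
    then have "p (\<lambda>w. \<forall>a\<in>{..<s}. q (\<lambda>u. P (w @ subst_word s [a] u)))"
      by (intro ultrafilter_on_ball[OF p]) auto
    then show ?thesis using i unfolding good_def by (simp add: ultrafilter_on_conj[OF p] P_def)
  qed
  then obtain w0 where w0: "w0 \<in> S" "good w0" by (rule ultrafilter_on_ex[OF p])
  have step: "q (\<lambda>u. good (w @ subst_word s [a] u))" if w: "good w" and a: "a < s" for w a
  proof -
    have "q (\<lambda>u. q (\<lambda>v. P ((w @ subst_word s [a] u) @ subst_word s [b] v)))" if "b < s" for b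
      using fun_cong[OF qq[OF a that], of "\<lambda>t. P (w @ t)"] w a unfolding uf_mult_def uf_subst_def good_def by simp
    then have "q (\<lambda>u. \<forall>b\<in>{..<s}. q (\<lambda>v. P ((w @ subst_word s [a] u) @ subst_word s [b] v)))"
      by (intro ultrafilter_on_ball[OF q]) auto
    then show ?thesis using w a unfolding good_def[of "w @ _"] good_def[of w] by (simp add: ultrafilter_on_conj[OF q])
  qed
  define I where "I n g \<longleftrightarrow> set g \<subseteq> {..<s + n} \<and>
    (\<forall>x. set x \<subseteq> {..<s} \<and> length x = n \<longrightarrow> good (subst_word s x g))" for n g
  have "\<exists>G. \<forall>n. I n (G n) \<and> (\<exists>z. G (Suc n) = G n @ (s + n) # z)"
  proof (rule dependent_nat_choice)
    show "\<exists>g. I 0 g" using w0 by (auto simp: I_def S_def subst_word_const intro!: exI[of _ w0])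
  next
    fix g n assume g: "I n g"
    define X where "X = {x. set x \<subseteq> {..<s} \<and> length x = n}"
    have "finite X" unfolding X_def by (rule finite_lists_length_eq) simp
    then have "q (\<lambda>u. \<forall>xa\<in>X \<times> {..<s}. good (subst_word s (fst xa) g @ subst_word s [snd xa] u))"
      by (intro ultrafilter_on_ball[OF q]) (use g step in \<open>auto simp: I_def X_def\<close>)
    then obtain u where u: "u \<in> VL" "\<forall>xa\<in>X \<times> {..<s}. good (subst_word s (fst xa) g @ subst_word s [snd xa] u)"
      by (rule ultrafilter_on_ex[OF q])
    obtain v where v: "u = s # v" "set v \<subseteq> {..<Suc s}" using u(1) by (auto simp: VL_def)
    \<comment> \<open>The variable of \<open>s # v\<close> is renamed as the parameter
      \<open>s + n\<close>; its leading occurrence is the one that a parameter space requires right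
      after \<open>g\<close>.\<close>
    define z where "z = subst_word s [s + n] v"
    have gs: "set g \<subseteq> {..<s + n}" using g by (simp add: I_def)
    have "set z \<subseteq> {..<s + Suc n}" unfolding z_def by (rule set_subst_word) (use v in auto)
    moreover have "good (subst_word s x (g @ (s + n) # z))" if x: "set x \<subseteq> {..<s}" "length x = Suc n" for x
    proof -
      obtain x' a where xa: "x = x' @ [a]" using x(2) by (cases x rule: rev_cases) auto
      have "subst_word s x g = subst_word s x' g" unfolding xa by (rule subst_word_extend) (use gs x xa in auto)
      moreover have "subst_word s x z = subst_word s [a] v" unfolding z_def
        by (subst subst_word_subst_word) (use v(2) x in \<open>auto simp: xa nth_append\<close>)
      moreover have "x ! n = a" using x by (simp add: xa nth_append)
      ultimately have "subst_word s x (g @ (s + n) # z) = subst_word s x' g @ subst_word s [a] u"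
        by (simp add: v(1))
      moreover have "(x', a) \<in> X \<times> {..<s}" using x by (auto simp: xa X_def)
      ultimately show ?thesis using u(2) by fastforce
    qed
    ultimately have "I (Suc n) (g @ (s + n) # z)" using gs by (auto simp: I_def)
    then show "\<exists>g'. I (Suc n) g' \<and> (\<exists>z. g' = g @ (s + n) # z)" by blast
  qed
  then obtain G where G: "\<And>n. I n (G n)" "\<And>n. \<exists>z. G (Suc n) = G n @ (s + n) # z" by blast
  have "param_space s G" using G by (auto simp: param_space_def I_def)
  moreover have "c (apply_word s G y) = i" if "set y \<subseteq> {..<s}" for y
    using G(1)[of "length y"] that by (auto simp: I_def apply_word_def good_def P_def)
  ultimately show ?thesis by (rule that)
qed

section \<open>Ramsey theorem for parameter words\<close>

lemma apply_word_id_space_arg: "param_space s G \<Longrightarrow> apply_word s G (id_space s j) = G j"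
  unfolding apply_word_def id_space_def using subst_word_upt[OF param_space_set, of s G j] by simp

text \<open>A parameter word contains all its parameters, so every letter of \<open>z\<close> is a
  constant or can be named by a position of \<open>y @ [s + k]\<close>. This translates the tails
  after any \<open>y\<close> of a given length into words over one larger alphabet of
  constants.\<close>

lemma lift_word:
  assumes "set z \<subseteq> {..<s + Suc k}" "param_word s k y"
  obtains z' where "length z' = length z" "set z' \<subseteq> {..<s + Suc (length y)}" "subst_word s (y @ [s + k]) z' = z"
proof -
  have "\<exists>c<s + Suc (length y). (if c < s then c else (y @ [s + k]) ! (c - s)) = d" if d: "d < s + Suc k" for d
  proof -
    consider "d < s" | "d \<in> {s..<s + k}" | "d = s + k" using d by force
    then show ?thesis
    proof cases
      case 1
      then show ?thesis by (intro exI[of _ d]) auto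
    next
      case 2
      then have "d \<in> set y" using param_word_contains[OF assms(2)] by blast
      then obtain j where "j < length y" "y ! j = d" by (auto simp: in_set_conv_nth)
      then show ?thesis by (intro exI[of _ "s + j"]) (auto simp: nth_append)
    next
      case 3
      then show ?thesis by (intro exI[of _ "s + length y"]) (auto simp: nth_append)
    qed
  qed
  then obtain h where h: "\<And>d. d < s + Suc k \<Longrightarrow>
      h d < s + Suc (length y) \<and> (if h d < s then h d else (y @ [s + k]) ! (h d - s)) = d"
    by metis
  show ?thesis
  proof (rule that[of "map h z"])
    show "set (map h z) \<subseteq> {..<s + Suc (length y)}" using h assms(1) by auto
    show "subst_word s (y @ [s + k]) (map h z) = z"
      unfolding subst_word_def map_map o_def by (rule map_idI) (use h assms(1) in blast)
  qed simp
qed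

lemma finite_param_word_length: "finite {y. param_word s k y \<and> length y = n}"
proof (rule finite_subset)
  show "{y. param_word s k y \<and> length y = n} \<subseteq> {y. set y \<subseteq> {..<s + k} \<and> length y = n}"
    using param_word_set by auto
qed (simp add: finite_lists_length_eq)

text \<open>Once this holds for all \<open>n\<close>, the colour depends only on the
  \<open>k\<close>-parameter word before the first occurrence of the last parameter, and the
  induction on \<open>k\<close> applies. The condition is secured for one length \<open>n\<close> at
  a time.\<close>

definition tail_indep :: "nat \<Rightarrow> nat \<Rightarrow> (nat list \<Rightarrow> 'c) \<Rightarrow> nat \<Rightarrow> (nat \<Rightarrow> nat list) \<Rightarrow> bool" where
  "tail_indep s k c n G \<longleftrightarrow> (\<forall>y z z'. param_word s k y \<and> length y = n \<and> set z \<subseteq> {..<s + Suc k} \<and> set z' \<subseteq> {..<s + Suc k} \<longrightarrow>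
     c (apply_word s G (y @ (s + k) # z)) = c (apply_word s G (y @ (s + k) # z')))"

lemma finite_range_map: "finite (range c) \<Longrightarrow> finite (range (\<lambda>t. map (\<lambda>y. c (f y t)) ys))"
  by (rule finite_subset[of _ "{l. set l \<subseteq> range c \<and> length l = length ys}"])
    (auto simp: finite_lists_length_eq)

text \<open>The first \<open>n + 1\<close> parameters are frozen and become additional constants.
  What follows is then a parameter word over \<open>s + Suc n\<close> constants, to which the
  Carlson-Simpson theorem applies.\<close>

lemma tail_indep_step:
  assumes fin: "finite (range c)" and G: "param_space s G"
  obtains K where "param_space s K" "\<And>j. j \<le> n \<Longrightarrow> K j = id_space s j" "tail_indep s k c n (comp_space s G K)"
proof -
  obtain ys where ys: "set ys = {y. param_word s k y \<and> length y = n}"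
    using finite_list[OF finite_param_word_length] by blast
  define C where "C t = map (\<lambda>y. c (apply_word s G (y @ (s + k) # subst_word s (y @ [s + k]) t))) ys" for t
  have "finite (range C)" unfolding C_def by (rule finite_range_map[OF fin])
  then have "finite (C ` {y. set y \<subseteq> {..<s + Suc n}})" by (rule finite_subset[rotated]) auto
  then obtain K' i where K': "param_space (s + Suc n) K'" "\<And>t. set t \<subseteq> {..<s + Suc n} \<Longrightarrow> C (apply_word (s + Suc n) K' t) = i"
    by (rule carlson_simpson_words) blast
  \<comment> \<open>The parameter \<open>n\<close> is frozen too, since position \<open>n\<close> of
    the words in question always carries \<open>s + k\<close>. The \<open>j\<close>-th parameter of
    \<open>K'\<close> is the letter \<open>s + Suc n + j\<close>, as \<open>K\<close> needs
    it.\<close>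
  define K where "K j = (if j \<le> n then id_space s j else id_space s (Suc n) @ K' (j - Suc n))" for j
  have "param_space s K"
    unfolding param_space_def
  proof (intro allI conjI)
    fix m
    show "set (K m) \<subseteq> {..<s + m}"
      using param_space_set[OF K'(1), of "m - Suc n"] by (auto simp: K_def id_space_def)
    consider "m < n" | "m = n" | m' where "m = Suc n + m'"
      by (metis add_Suc less_iff_Suc_add not_less_iff_gr_or_eq)
    then show "\<exists>z. K (Suc m) = K m @ (s + m) # z"
    proof cases
      case 3
      obtain z where "K' (Suc m') = K' m' @ (s + Suc n + m') # z" using K'(1) unfolding param_space_def by blast
      then show ?thesis using 3 by (simp add: K_def add.assoc)
    qed (auto simp: K_def id_space_def)
  qed
  moreover have "tail_indep s k c n (comp_space s G K)"
  proof -
    have key: "\<exists>t. set t \<subseteq> {..<s + Suc n} \<and>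
      apply_word s K (y @ (s + k) # z) = y @ (s + k) # subst_word s (y @ [s + k]) (apply_word (s + Suc n) K' t)"
      if y: "param_word s k y" "length y = n" and z: "set z \<subseteq> {..<s + Suc k}" for y z
    proof -
      obtain t where t: "length t = length z" "set t \<subseteq> {..<s + Suc (length y)}" "subst_word s (y @ [s + k]) t = z"
        using lift_word[OF z y(1)] .
      define x where "x = y @ (s + k) # z"
      have x1: "subst_word s x (id_space s (Suc n)) = y @ [s + k]"
        by (rule nth_equalityI) (auto simp: id_space_def x_def y(2) subst_word_def nth_append less_Suc_eq)
      have "subst_word s x (K' (length z)) = subst_word s (y @ [s + k]) (subst_word (s + Suc n) t (K' (length z)))"
      proof -
        have "(if e < s then e else x ! (e - s)) =
           (if e' < s then e' else (y @ [s + k]) ! (e' - s))"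
          if e: "e \<in> set (K' (length z))" and e': "e' = (if e < s + Suc n then e else t ! (e - (s + Suc n)))" for e e'
        proof (cases "e < s + Suc n")
          case True
          then show ?thesis using e' y(2) by (auto simp: x_def nth_append)
        next
          case False
          have "e < s + Suc n + length z" using e param_space_set[OF K'(1)] by blast
          then have l: "e - (s + Suc n) < length z" using False by auto
          have "z ! (e - (s + Suc n)) = (if e' < s then e' else (y @ [s + k]) ! (e' - s))"
            using l t(1) e' False by (subst t(3)[symmetric]) (simp add: subst_word_def)
          moreover have "x ! (e - s) = z ! (e - (s + Suc n))"
          proof -
            have "e - s = length (y @ [s + k]) + (e - (s + Suc n))" using False y(2) by simp
            moreover have "x = (y @ [s + k]) @ z" by (simp add: x_def)
            ultimately show ?thesis by (simp only: nth_append_length_plus)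
          qed
          ultimately show ?thesis using False by simp
        qed
        then show ?thesis by (simp add: subst_word_def)
      qed
      moreover have "apply_word s K x = subst_word s x (id_space s (Suc n)) @ subst_word s x (K' (length z))"
        by (simp add: apply_word_def K_def x_def y(2))
      ultimately have "apply_word s K x = (y @ [s + k]) @ subst_word s (y @ [s + k]) (apply_word (s + Suc n) K' t)"
        using x1 t(1) by (simp add: apply_word_def)
      moreover have "set t \<subseteq> {..<s + Suc n}" using t(2) y(2) by simp
      ultimately show ?thesis unfolding x_def by auto
    qed
    show ?thesis
      unfolding tail_indep_def
    proof (intro allI impI, elim conjE)
      fix y z z' assume y: "param_word s k y" "length y = n" and z: "set z \<subseteq> {..<s + Suc k}" "set z' \<subseteq> {..<s + Suc k}"
      then have yy: "y \<in> set ys" using ys by simp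
      obtain t where t: "set t \<subseteq> {..<s + Suc n}" 
        "apply_word s K (y @ (s + k) # z) = y @ (s + k) # subst_word s (y @ [s + k]) (apply_word (s + Suc n) K' t)"
        using key[OF y z(1)] by (elim exE conjE)
      obtain t' where t': "set t' \<subseteq> {..<s + Suc n}" 
        "apply_word s K (y @ (s + k) # z') = y @ (s + k) # subst_word s (y @ [s + k]) (apply_word (s + Suc n) K' t')"
        using key[OF y z(2)] by (elim exE conjE)
      have "C (apply_word (s + Suc n) K' t) = C (apply_word (s + Suc n) K' t')" using K'(2) t(1) t'(1) by simp
      then show "c (apply_word s (comp_space s G K) (y @ (s + k) # z)) = c (apply_word s (comp_space s G K) (y @ (s + k) # z'))"
        using yy unfolding C_def map_eq_conv apply_word_comp_space[OF G] t(2) t'(2) by blast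
    qed
  qed
  moreover have "K j = id_space s j" if "j \<le> n" for j using that by (simp add: K_def)
  ultimately show ?thesis by (intro that[of K])
qed

text \<open>\<open>K\<close> is the identity on short words, so it fixes \<open>y\<close> and merely
  exchanges one tail for another. Later stages of the fusion thus preserve what earlier ones
  achieved.\<close>

lemma tail_indep_comp_space:
  assumes "param_space s G" "param_space s K" "\<And>j. j \<le> m \<Longrightarrow> K j = id_space s j" "n \<le> m" "tail_indep s k c n G"
  shows "tail_indep s k c n (comp_space s G K)"
proof -
  have "\<exists>z'. set z' \<subseteq> {..<s + Suc k} \<and> apply_word s K (y @ (s + k) # z) = y @ (s + k) # z'"
    if y: "param_word s k y" "length y = n" and z: "set z \<subseteq> {..<s + Suc k}" for y z
  proof -
    obtain z' where z': "apply_word s K (y @ (s + k) # z) = apply_word s K y @ (s + k) # z'" using apply_word_Cons[OF assms(2)] .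
    have "apply_word s K y = y" using apply_word_id_space[of s y] assms(3,4) y(2) by (simp add: apply_word_def)
    moreover have "set (apply_word s K (y @ (s + k) # z)) \<subseteq> {..<s + Suc k}"
      using param_word_set[OF y(1)] z by (intro set_apply_word[OF assms(2)]) auto
    ultimately show ?thesis using z' by auto
  qed
  then show ?thesis using assms(5) unfolding tail_indep_def apply_word_comp_space[OF assms(1)] by metis
qed

theorem parameter_word_ramsey:
  assumes "finite (range c)"
  shows "\<exists>G i. param_space s G \<and> (\<forall>y. param_word s k y \<longrightarrow> c (apply_word s G y) = i)"
  using assms
proof (induction k arbitrary: c)
  case 0
  then have "finite (c ` {y. set y \<subseteq> {..<s}})" by (rule finite_subset[rotated]) auto
  then show ?case by (rule carlson_simpson_words) auto
next
  case (Suc k)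
  define I where "I i G \<longleftrightarrow> param_space s G \<and> (\<forall>n<i. tail_indep s k c n G)" for i G
  define J where "J i G G' \<longleftrightarrow> (\<exists>K. param_space s K \<and> (\<forall>j\<le>i. K j = id_space s j) \<and> G' = comp_space s G K)" for i G G'
  have "\<exists>Gs. \<forall>i. I i (Gs i) \<and> J i (Gs i) (Gs (Suc i))"
  proof (rule dependent_nat_choice)
    show "\<exists>G. I 0 G" using param_space_id_space by (auto simp: I_def)
  next
    fix G i assume G: "I i G"
    then have Gs: "param_space s G" by (simp add: I_def)
    obtain K where K: "param_space s K" "\<And>j. j \<le> i \<Longrightarrow> K j = id_space s j" "tail_indep s k c i (comp_space s G K)"
      using tail_indep_step[OF Suc.prems Gs] by blast
    have "tail_indep s k c n (comp_space s G K)" if "n < i" for n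
      by (rule tail_indep_comp_space[OF Gs K(1) K(2)]) (use that G in \<open>auto simp: I_def\<close>)
    then have "I (Suc i) (comp_space s G K)" using K Gs param_space_comp_space by (auto simp: I_def less_Suc_eq)
    then show "\<exists>G'. I (Suc i) G' \<and> J i G G'" using K unfolding J_def by blast
  qed
  then obtain Gs where Gs: "\<And>i. I i (Gs i)" "\<And>i. J i (Gs i) (Gs (Suc i))" by blast
  have spcG: "param_space s (Gs i)" for i using Gs(1)[of i] by (simp add: I_def)
  \<comment> \<open>Stage \<open>i\<close> composes with a word that is the identity up to index
    \<open>i\<close>. So the entry at \<open>j\<close> is stable from stage \<open>j\<close> on, and
    the diagonal \<open>U\<close> below is a parameter word.\<close>
  have agree1: "Gs (Suc i) j = Gs i j" if "j \<le> i" for i j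
    using Gs(2)[of i] that apply_word_id_space_arg[OF spcG] by (auto simp: J_def comp_space_def)
  have agree: "Gs (j + d) j = Gs j j" for j d
    by (induction d) (use agree1 in auto)
  define U where "U m = Gs m m" for m
  have U: "param_space s U"
    unfolding param_space_def
  proof (intro allI conjI)
    fix m
    show "set (U m) \<subseteq> {..<s + m}" unfolding U_def by (rule param_space_set[OF spcG])
    show "\<exists>z. U (Suc m) = U m @ (s + m) # z"
    proof -
      obtain z where "Gs (Suc m) (Suc m) = Gs (Suc m) m @ (s + m) # z" using spcG[of "Suc m"] unfolding param_space_def by blast
      then show ?thesis using agree1[of m m] by (simp add: U_def)
    qed
  qed
  have apU: "apply_word s U x = apply_word s (Gs N) x" if "length x \<le> N" for x N
    using agree[of "length x" "N - length x"] that by (simp add: apply_word_def U_def)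
  have ti: "c (apply_word s U (y @ (s + k) # z)) = c (apply_word s U (y @ (s + k) # z'))"
    if "param_word s k y" "set z \<subseteq> {..<s + Suc k}" "set z' \<subseteq> {..<s + Suc k}" for y z z'
  proof -
    define N where "N = Suc (length y) + length z + length z'"
    have "tail_indep s k c (length y) (Gs N)" using Gs(1)[of N] by (simp add: I_def N_def)
    then have "c (apply_word s (Gs N) (y @ (s + k) # z)) = c (apply_word s (Gs N) (y @ (s + k) # z'))"
      using that unfolding tail_indep_def by blast
    then show ?thesis by (simp add: apU[of _ N] N_def)
  qed
  \<comment> \<open>By \<open>ti\<close> the tail does not matter, so the empty tail represents all
    of them.\<close>
  define c' where "c' y = c (apply_word s U (y @ [s + k]))" for y
  have "finite (range c')" by (rule finite_subset[OF _ Suc.prems]) (auto simp: c'_def)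
  then obtain V i where V: "param_space s V" "\<And>y. param_word s k y \<Longrightarrow> c' (apply_word s V y) = i" using Suc.IH by blast
  have "c (apply_word s (comp_space s U V) y) = i" if y: "param_word s (Suc k) y" for y
  proof -
    obtain y' z where yz: "y = y' @ (s + k) # z" "param_word s k y'" using y by auto
    obtain z' where z': "apply_word s V y = apply_word s V y' @ (s + k) # z'" unfolding yz(1) using apply_word_Cons[OF V(1)] .
    have "set (apply_word s V y) \<subseteq> {..<s + Suc k}" by (rule param_word_set[OF param_word_apply_word[OF V(1) y]])
    then have "c (apply_word s U (apply_word s V y)) = c (apply_word s U (apply_word s V y' @ [s + k]))"
      unfolding z' by (intro ti param_word_apply_word[OF V(1) yz(2)]) auto
    then show ?thesis using V(2)[OF yz(2)] by (simp add: apply_word_comp_space[OF U] c'_def)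
  qed
  then show ?case using param_space_comp_space[OF U V(1)] by blast
qed

text \<open>Envelopes of different tuples have different numbers of parameters, so one parameter
  word must serve all \<open>k < n\<close>. Refining it is harmless because substitution maps
  \<open>k\<close>-parameter words to \<open>k\<close>-parameter words.\<close>

corollary parameter_word_ramsey_all:
  assumes "\<And>k. finite (range (c k))"
  shows "\<exists>U. param_space s U \<and> (\<forall>k<n. \<forall>y y'. param_word s k y \<longrightarrow> param_word s k y' \<longrightarrow> c k (apply_word s U y) = c k (apply_word s U y'))"
proof (induction n)
  case 0
  then show ?case using param_space_id_space by auto
next
  case (Suc n)
  then obtain U where U: "param_space s U" "\<And>k y y'. k < n \<Longrightarrow> param_word s k y \<Longrightarrow> param_word s k y' \<Longrightarrow> c k (apply_word s U y) = c k (apply_word s U y')"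
    by blast
  have "finite (range (\<lambda>y. c n (apply_word s U y)))" by (rule finite_subset[OF _ assms[of n]]) auto
  then obtain V i where V: "param_space s V" "\<And>y. param_word s n y \<Longrightarrow> c n (apply_word s U (apply_word s V y)) = i"
    using parameter_word_ramsey by metis
  have "c k (apply_word s (comp_space s U V) y) = c k (apply_word s (comp_space s U V) y')" if "k < Suc n" "param_word s k y" "param_word s k y'" for k y y'
  proof (cases "k = n")
    case True
    then show ?thesis using V(2) that by (simp add: apply_word_comp_space[OF U(1)])
  next
    case False
    then have "k < n" using that(1) by simp
    then show ?thesis unfolding apply_word_comp_space[OF U(1)] by (rule U(2)[OF _ param_word_apply_word[OF V(1) that(2)] param_word_apply_word[OF V(1) that(3)]])
  qed
  then show ?case using param_space_comp_space[OF U(1) V(1)] by blast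
qed

section \<open>Big Ramsey degrees of tuples of words\<close>

text \<open>The substitution is truncated before the first parameter that has no letter in \<open>u\<close>.\<close>

definition eval_word :: "nat \<Rightarrow> nat list \<Rightarrow> nat list \<Rightarrow> nat list" where
  "eval_word s y u = subst_word s u (takeWhile (\<lambda>c. c < s + length u) y)"

text \<open>The first letter of \<open>y\<close> that is cut off survives the substitution by
  \<open>apply_word_Cons\<close>, and the letters before it stay below the bound, so both
  truncations happen at the same place. Thus \<open>U\<close> may act on the envelope instead of on
  the tuple.\<close>

lemma eval_word_apply_word:
  assumes U: "param_space s U"
  shows "eval_word s (apply_word s U y) u = apply_word s U (eval_word s y u)"
proof -
  define P where "P c \<longleftrightarrow> c < s + length u" for c
  define y' where "y' = takeWhile P y"
  have "set y' \<subseteq> {..<s + length u}" unfolding y'_def P_def by (auto dest: set_takeWhileD)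
  then have s': "set (apply_word s U y') \<subseteq> {..<s + length u}" by (rule set_apply_word[OF U]) simp
  have "takeWhile P (apply_word s U y) = apply_word s U y'"
  proof (cases "dropWhile P y")
    case Nil
    then have "y = y'" unfolding y'_def by (metis append_Nil2 takeWhile_dropWhile_id)
    then show ?thesis using s' by (auto simp: takeWhile_eq_all_conv P_def subset_iff)
  next
    case (Cons a z)
    then have "y = y' @ a # z" unfolding y'_def by (metis takeWhile_dropWhile_id)
    then obtain z' where z': "apply_word s U y = apply_word s U y' @ a # z'" using apply_word_Cons[OF U] by metis
    have "\<not> P a" using Cons by (metis dropWhile_eq_Cons_conv)
    then show ?thesis unfolding z' using s' by (subst takeWhile_append2) (auto simp: P_def subset_iff)
  qed
  then show ?thesis unfolding eval_word_def y'_def P_def by (simp add: subst_word_apply_word[OF U])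
qed

lemma param_word_snoc:
  assumes "param_word s k y" "a < s + k"
  shows "param_word s k (y @ [a])"
proof (cases k)
  case 0
  then show ?thesis using assms by simp
next
  case (Suc k')
  then obtain y' z where y: "y = y' @ (s + k') # z" "param_word s k' y'" "set z \<subseteq> {..<s + Suc k'}"
    using assms(1) by auto
  then have "y @ [a] = y' @ (s + k') # (z @ [a])" "set (z @ [a]) \<subseteq> {..<s + Suc k'}"
    using assms(2) Suc by auto
  then show ?thesis using y(2) unfolding Suc param_word.simps by blast
qed

text \<open>\<open>ds\<close> numbers the entries of \<open>cs\<close> by first occurrence and
  \<open>y\<close> spells \<open>cs\<close> in these numbers, which makes \<open>y\<close> a
  parameter word. The last clause ensures later that no evaluation is cut off too early.\<close>

lemma first_occurrence_word:
  fixes cs :: "'b list"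
  shows "\<exists>ds y. length y = length cs \<and> distinct ds \<and> set ds = set cs \<and> param_word s (length ds) y \<and> set y \<subseteq> {s..} \<and>
    (\<forall>j<length cs. y ! j - s < length ds \<and> ds ! (y ! j - s) = cs ! j \<and> (\<forall>l\<le>y ! j - s. \<exists>j'\<le>j. ds ! l = cs ! j'))"
proof (induction cs rule: rev_induct)
  case Nil
  then show ?case by (intro exI[of _ "[]"]) auto
next
  case (snoc c cs)
  then obtain ds y where h: "length y = length cs" "distinct ds" "set ds = set cs" "param_word s (length ds) y" "set y \<subseteq> {s..}"
    and nth: "\<And>j. j < length cs \<Longrightarrow> y ! j - s < length ds \<and> ds ! (y ! j - s) = cs ! j"
    and first: "\<And>j l. j < length cs \<Longrightarrow> l \<le> y ! j - s \<Longrightarrow> \<exists>j'\<le>j. ds ! l = cs ! j'"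
    by blast
  have mem: "\<exists>j'\<le>length cs. ds ! l = (cs @ [c]) ! j'" if "l < length ds" for l
  proof -
    have "ds ! l \<in> set cs" using that h(3) nth_mem by blast
    then obtain j' where "j' < length cs" "cs ! j' = ds ! l" by (auto simp: in_set_conv_nth)
    then show ?thesis by (intro exI[of _ j']) (auto simp: nth_append)
  qed
  have firstc: "\<exists>j'\<le>j. ds ! l = (cs @ [c]) ! j'" if "j < length cs" "l \<le> y ! j - s" for j l
  proof -
    obtain j' where "j' \<le> j" "ds ! l = cs ! j'" using first \<open>j < length cs\<close> \<open>l \<le> y ! j - s\<close> by blast
    then show ?thesis using \<open>j < length cs\<close> by (intro exI[of _ j']) (auto simp: nth_append)
  qed
  show ?case
  proof (cases "c \<in> set ds")
    case True
    then obtain l0 where l0: "l0 < length ds" "ds ! l0 = c" by (auto simp: in_set_conv_nth)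
    show ?thesis
    proof (intro exI[of _ ds] exI[of _ "y @ [s + l0]"] conjI allI impI)
      fix j assume j: "j < length (cs @ [c])"
      have jj: "j < length cs \<or> j = length cs" using j by auto
      then show "(y @ [s + l0]) ! j - s < length ds" "ds ! ((y @ [s + l0]) ! j - s) = (cs @ [c]) ! j"
        using h(1) nth l0 by (auto simp: nth_append)
      fix l assume l: "l \<le> (y @ [s + l0]) ! j - s"
      show "\<exists>j'\<le>j. ds ! l = (cs @ [c]) ! j'"
      proof (cases "j < length cs")
        case True
        then have "l \<le> y ! j - s" using l h(1) by (simp add: nth_append)
        then show ?thesis by (rule firstc[OF True])
      next
        case False
        then have "j = length cs" "l \<le> l0" using jj l h(1) by (auto simp: nth_append)
        then show ?thesis using mem[of l] l0 by auto
      qed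
    qed (use h l0 True in \<open>auto intro: param_word_snoc\<close>)
  next
    case False
    have ll: "(ds @ [c]) ! l = ds ! l" if "j < length cs" "l \<le> y ! j - s" for j l
      using nth[of j] that by (simp add: nth_append)
    have pwS: "param_word s (length (ds @ [c])) (y @ [s + length ds])"
      using h(4) by (auto intro: exI[of _ y] exI[of _ "[]"])
    show ?thesis
    proof (intro exI[of _ "ds @ [c]"] exI[of _ "y @ [s + length ds]"] conjI allI impI)
      fix j assume j: "j < length (cs @ [c])"
      have jj: "j < length cs \<or> j = length cs" using j by auto
      then show "(y @ [s + length ds]) ! j - s < length (ds @ [c])"
        "(ds @ [c]) ! ((y @ [s + length ds]) ! j - s) = (cs @ [c]) ! j"
        using h(1) nth by (auto simp: nth_append intro: less_SucI)
      fix l assume l: "l \<le> (y @ [s + length ds]) ! j - s"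
      show "\<exists>j'\<le>j. (ds @ [c]) ! l = (cs @ [c]) ! j'"
      proof (cases "j < length cs")
        case True
        then have "l \<le> y ! j - s" using l h(1) by (simp add: nth_append)
        then show ?thesis using firstc[OF True] ll[OF True] by simp
      next
        case False
        then have "j = length cs" using jj by auto
        then have le: "l \<le> length ds" using l h(1) by (simp add: nth_append)
        show ?thesis
        proof (cases "l < length ds")
          case True
          then show ?thesis using mem[OF True] \<open>j = length cs\<close> by (simp add: nth_append)
        next
          case False
          then have "(ds @ [c]) ! l = c" using le by (simp add: nth_append)
          then show ?thesis using \<open>j = length cs\<close> by (intro exI[of _ j]) simp
        qed
      qed
    qed (use h(1-3,5) False pwS in \<open>auto simp del: param_word.simps\<close>)
  qed
qed

text \<open>The words are the rows of a table, padded by the end marker \<open>s\<close>; the bound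
  counts the possible columns. \<open>y\<close> lists the columns by number, and the
  \<open>i\<close>-th short word is row \<open>i\<close> of the list of distinct columns.\<close>

lemma word_tuple_envelope:
  assumes xs: "\<And>x. x \<in> set xs \<Longrightarrow> set x \<subseteq> {..<s}"
  obtains k y us where "k \<le> Suc s ^ length xs" "param_word s k y" "length us = length xs"
    "\<And>u. u \<in> set us \<Longrightarrow> set u \<subseteq> {..<s} \<and> length u \<le> k" "map (eval_word s y) us = xs"
proof -
  define N where "N = sum_list (map length xs)"
  have N: "length (xs ! i) \<le> N" if "i < length xs" for i
    unfolding N_def using that by (intro member_le_sum_list) auto
  define cs where "cs = map (\<lambda>j. map (\<lambda>x. if j < length x then x ! j else s) xs) [0..<N]"
  have csN: "length cs = N" by (simp add: cs_def)
  have cs: "cs ! j ! i = (if j < length (xs ! i) then xs ! i ! j else s)" if "j < N" "i < length xs" for i j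
    using that by (simp add: cs_def)
  obtain ds y where h: "length y = length cs" "distinct ds" "set ds = set cs" "param_word s (length ds) y" "set y \<subseteq> {s..}"
    and nth: "\<And>j. j < length cs \<Longrightarrow> y ! j - s < length ds \<and> ds ! (y ! j - s) = cs ! j"
    and first: "\<And>j l. j < length cs \<Longrightarrow> l \<le> y ! j - s \<Longrightarrow> \<exists>j'\<le>j. ds ! l = cs ! j'"
    using first_occurrence_word[of cs s] by blast
  have "set cs \<subseteq> {c. set c \<subseteq> {..s} \<and> length c = length xs}"
  proof
    fix c assume "c \<in> set cs"
    then obtain j where c: "c = map (\<lambda>x. if j < length x then x ! j else s) xs" by (auto simp: cs_def)
    have "(if j < length x then x ! j else s) \<le> s" if "x \<in> set xs" for x
    proof (cases "j < length x")
      case True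
      then have "x ! j \<in> {..<s}" using xs[OF that] nth_mem by blast
      then show ?thesis using True by simp
    qed simp
    then have "set c \<subseteq> {..s}" unfolding c set_map atMost_def by (rule image_subsetI[OF CollectI])
    then show "c \<in> {c. set c \<subseteq> {..s} \<and> length c = length xs}" by (simp add: c)
  qed
  then have "card (set cs) \<le> card {c. set c \<subseteq> {..s} \<and> length c = length xs}"
    by (rule card_mono[rotated]) (simp add: finite_lists_length_eq)
  then have k: "length ds \<le> Suc s ^ length xs"
    using distinct_card[OF h(2)] h(3) by (simp add: card_lists_length_eq)
  \<comment> \<open>Row \<open>i\<close> of the distinct columns is cut at its first end
    marker.\<close>
  define u where "u i = takeWhile (\<lambda>c. c < s) (map (\<lambda>d. d ! i) ds)" for i
  have eval_word: "eval_word s y (u i) = xs ! i" if i: "i < length xs" for i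
  proof -
    define x where "x = xs ! i"
    have xN: "length x \<le> N" using N[OF i] by (simp add: x_def)
    have xs_lt: "x ! j < s" if "j < length x" for j
    proof -
      have "x \<in> set xs" using i by (simp add: x_def)
      then have "x ! j \<in> {..<s}" using xs[of x] nth_mem[OF that] by blast
      then show ?thesis by simp
    qed
    have lenu: "length (u i) \<le> length ds" 
      using length_takeWhile_le[of "\<lambda>c. c < s" "map (\<lambda>d. d ! i) ds"] by (simp add: u_def)
    have u_nth: "u i ! l = ds ! l ! i" "u i ! l < s" if "l < length (u i)" for l
    proof -
      have "u i ! l = map (\<lambda>d. d ! i) ds ! l"
        using takeWhile_nth[OF that[unfolded u_def]] unfolding u_def .
      then show "u i ! l = ds ! l ! i" using that lenu by simp
      show "u i ! l < s" using nth_mem[OF that] unfolding u_def by (auto dest: set_takeWhileD)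
    qed
    \<comment> \<open>Every column numbered at most as column \<open>j\<close> occurs by position
      \<open>j\<close>, where row \<open>i\<close> still carries a letter of \<open>x\<close>. So
      the first end marker in row \<open>i\<close> of \<open>ds\<close> comes after this
      number.\<close>
    have below: "y ! j - s < length (u i)" if j: "j < length x" for j
    proof (rule ccontr)
      assume "\<not> y ! j - s < length (u i)"
      then have le: "length (u i) \<le> y ! j - s" by simp
      have jN: "j < length cs" using j xN csN by simp
      have "length (u i) < length ds" using le nth[OF jN] by simp
      then have "\<not> ds ! length (u i) ! i < s"
        using nth_length_takeWhile[of "\<lambda>c. c < s" "map (\<lambda>d. d ! i) ds"] unfolding u_def by simp
      moreover obtain j' where "j' \<le> j" "ds ! length (u i) = cs ! j'" using first[OF jN le] by blast
      ultimately show False using cs[of j' i] i j xs_lt[of j'] jN csN by (simp add: x_def)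
    qed
    have "takeWhile (\<lambda>c. c < s + length (u i)) y = take (length x) y"
    proof (rule takeWhile_eq_take_P_nth)
      fix j assume "j < length x" "j < length y"
      then show "y ! j < s + length (u i)" using below[OF \<open>j < length x\<close>] by arith
    next
      \<comment> \<open>Column \<open>length x\<close> has the end marker in row \<open>i\<close>,
        so the truncation stops exactly there.\<close>
      assume a: "length x < length y"
      then have l: "length x < length cs" using h(1) by simp
      then have "ds ! (y ! length x - s) ! i = cs ! length x ! i" using nth[OF l] by simp
      also have "\<dots> = s" using cs[of "length x" i] i l csN by (simp add: x_def)
      finally have ds: "ds ! (y ! length x - s) ! i = s" .
      have "\<not> y ! length x - s < length (u i)"
      proof
        assume "y ! length x - s < length (u i)"
        from u_nth[OF this] show False by (simp add: ds)
      qed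
      moreover have "y ! length x \<ge> s" using h(5) nth_mem[OF a] by auto
      ultimately show "\<not> y ! length x < s + length (u i)" by linarith
    qed
    moreover have "subst_word s (u i) (take (length x) y) = x"
    proof (rule nth_equalityI)
      show "length (subst_word s (u i) (take (length x) y)) = length x" using xN h(1) csN by simp
      fix j assume "j < length (subst_word s (u i) (take (length x) y))"
      then have j: "j < length x" "j < length y" by auto
      have "y ! j \<ge> s" using h(5) nth_mem[OF j(2)] by auto
      then have "subst_word s (u i) (take (length x) y) ! j = u i ! (y ! j - s)"
      proof -
        have "subst_word s (u i) (take (length x) y) ! j = (if y ! j < s then y ! j else u i ! (y ! j - s))"
          using j by (simp add: subst_word_def)
        then show ?thesis using \<open>y ! j \<ge> s\<close> by (simp split: if_splits)
      qed
      also have "\<dots> = ds ! (y ! j - s) ! i" by (rule u_nth(1)[OF below[OF j(1)]])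
      also have "\<dots> = cs ! j ! i" using nth j(2) h(1) by simp
      also have "\<dots> = x ! j" using cs[of j i] i j xN by (simp add: x_def)
      finally show "subst_word s (u i) (take (length x) y) ! j = x ! j" .
    qed
    ultimately show ?thesis by (simp add: eval_word_def x_def)
  qed
  show ?thesis
  proof (rule that[OF k h(4)])
    show "length (map u [0..<length xs]) = length xs" by simp
    show "map (eval_word s y) (map u [0..<length xs]) = xs" using eval_word by (intro nth_equalityI) auto
    fix v assume "v \<in> set (map u [0..<length xs])"
    then obtain i where "v = u i" by auto
    then show "set v \<subseteq> {..<s} \<and> length v \<le> length ds"
      using length_takeWhile_le[of _ "map (\<lambda>d. d ! i) ds"] by (auto simp: u_def dest: set_takeWhileD)
  qed
qed

text \<open>The bound counts pairs of a number of parameters and a tuple of short words, hence is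
  fixed before the colouring. For a homogeneous \<open>U\<close> the colour of a tuple depends on
  its pair alone, not on its envelope. The \<open>Suc\<close> in the bound makes it
  positive.\<close>

theorem word_tuple_ramsey:
  obtains t :: nat where "t > 0"
    "\<And>\<phi> :: nat list list \<Rightarrow> 'c. finite (range \<phi>) \<Longrightarrow> \<exists>U. param_space s U \<and>
      card (\<phi> ` {map (apply_word s U) xs | xs. length xs = n \<and> (\<forall>x\<in>set xs. set x \<subseteq> {..<s})}) \<le> t"
proof -
  define Us where "Us k = {us. set us \<subseteq> {u. set u \<subseteq> {..<s} \<and> length u \<le> k} \<and> length us = n}" for k
  have finU: "finite (Us k)" for k
    unfolding Us_def by (intro finite_lists_length_eq finite_lists_length_le) simp
  define T where "T = (SIGMA k:{..Suc s ^ n}. Us k)"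
  have finT: "finite T" unfolding T_def by (intro finite_SigmaI finU) simp
  show ?thesis
  proof (rule that[of "Suc (card T)"])
    fix \<phi> :: "nat list list \<Rightarrow> 'c" assume fin: "finite (range \<phi>)"
    have "\<exists>l. set l = Us k" for k by (rule finite_list[OF finU])
    then obtain ul where ul: "\<And>k. set (ul k) = Us k" by metis
    define c where "c k y = map (\<lambda>us. \<phi> (map (eval_word s y) us)) (ul k)" for k y
    have "finite (range (c k))" for k unfolding c_def by (rule finite_range_map[OF fin])
    then obtain U where U: "param_space s U" and hom: "\<And>k y y'. k < Suc (Suc s ^ n) \<Longrightarrow> param_word s k y \<Longrightarrow> param_word s k y' \<Longrightarrow>
        c k (apply_word s U y) = c k (apply_word s U y')"
      using parameter_word_ramsey_all[of c s "Suc (Suc s ^ n)"] by blast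
    define yk where "yk k = (SOME y. param_word s k y)" for k
    define val where "val = (\<lambda>(k, us). \<phi> (map (eval_word s (apply_word s U (yk k))) us))"
    have types: "\<phi> ` {map (apply_word s U) xs | xs. length xs = n \<and> (\<forall>x\<in>set xs. set x \<subseteq> {..<s})} \<subseteq> val ` T"
    proof (rule subsetI)
      fix v assume "v \<in> \<phi> ` {map (apply_word s U) xs | xs. length xs = n \<and> (\<forall>x\<in>set xs. set x \<subseteq> {..<s})}"
      then obtain xs where v: "v = \<phi> (map (apply_word s U) xs)" and xs: "n = length xs" "\<forall>x\<in>set xs. set x \<subseteq> {..<s}"
        by auto
      obtain k y us where e: "k \<le> Suc s ^ length xs" "param_word s k y" "length us = length xs"
        "\<And>u. u \<in> set us \<Longrightarrow> set u \<subseteq> {..<s} \<and> length u \<le> k" "map (eval_word s y) us = xs"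
        by (rule word_tuple_envelope[of xs s]) (use xs(2) in blast)+
      have us: "us \<in> Us k" using e(3,4) xs(1) by (auto simp: Us_def)
      have yk: "param_word s k (yk k)" unfolding yk_def by (rule someI[of "param_word s k", OF e(2)])
      have "k < Suc (Suc s ^ n)" using e(1) xs(1) by simp
      then have "c k (apply_word s U y) = c k (apply_word s U (yk k))" by (rule hom[OF _ e(2) yk])
      then have m1: "\<phi> (map (eval_word s (apply_word s U y)) us) = val (k, us)"
        using us unfolding c_def map_eq_conv ul val_def by simp
      have "map (apply_word s U) xs = map (apply_word s U) (map (eval_word s y) us)"
        by (rule arg_cong[OF e(5)[symmetric]])
      also have "\<dots> = map (eval_word s (apply_word s U y)) us" by (simp add: eval_word_apply_word[OF U])
      finally have "v = val (k, us)" using m1 v by simp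
      moreover have "(k, us) \<in> T" using us e(1) xs(1) by (simp add: T_def)
      ultimately show "v \<in> val ` T" by (rule image_eqI)
    qed
    have "card (\<phi> ` {map (apply_word s U) xs | xs. length xs = n \<and> (\<forall>x\<in>set xs. set x \<subseteq> {..<s})}) \<le> card (val ` T)"
      by (rule card_mono[OF finite_imageI[OF finT] types])
    also have "\<dots> \<le> Suc (card T)" by (rule le_SucI[OF card_image_le[OF finT]])
    finally have "card (\<phi> ` {map (apply_word s U) xs | xs. length xs = n \<and> (\<forall>x\<in>set xs. set x \<subseteq> {..<s})}) \<le> Suc (card T)" .
    then show "\<exists>U. param_space s U \<and>
      card (\<phi> ` {map (apply_word s U) xs | xs. length xs = n \<and> (\<forall>x\<in>set xs. set x \<subseteq> {..<s})}) \<le> Suc (card T)"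
      using U by blast
  qed simp
qed

section \<open>The product order on words\<close>

lemma append_Cons_less_append_Cons: "a < b \<Longrightarrow> p @ a # r < p @ b # r'"
  for a b :: "'a::linorder"
  by (induction p) auto

lemma less_append_Cons: "p < p @ b # r"
  for b :: "'a::linorder"
  by (induction p) auto

lemma list_less_cases:
  fixes x y :: "'a::linorder list"
  assumes "x < y"
  obtains (prefix) b r where "y = x @ b # r"
  | (differ) p a b r r' where "x = p @ a # r" "y = p @ b # r'" "a < b"
proof -
  have "(\<exists>b r. y = x @ b # r) \<or> (\<exists>p a b r r'. x = p @ a # r \<and> y = p @ b # r' \<and> a < b)"
    using assms
  proof (induction x arbitrary: y)
    case Nil
    then show ?case by (cases y) auto
  next
    case (Cons a x)
    then obtain b y' where y: "y = b # y'" by (cases y) auto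
    show ?case
    proof (cases "a < b")
      case True
      then show ?thesis using y by (metis append_Nil)
    next
      case False
      then have ab: "a = b" and "x < y'" using Cons.prems y by auto
      from Cons.IH[OF this(2)] show ?thesis
      proof (elim disjE exE conjE)
        fix p a' b' r r' assume "x = p @ a' # r" "y' = p @ b' # r'" "a' < b'"
        then have "a # x = (a # p) @ a' # r" "y = (a # p) @ b' # r'" using y ab by auto
        then show ?thesis using \<open>a' < b'\<close> by blast
      qed (use y ab in auto)
    qed
  qed
  then show ?thesis using that by blast
qed

lemma map_apply_word_cong:
  assumes "param_space s U" "map f x = map f y"
  shows "map f (apply_word s U x) = map f (apply_word s U y)"
proof -
  have l: "length x = length y" using assms(2) map_eq_imp_length_eq by blast
  have "f (x ! i) = f (y ! i)" if "i < length x" for i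
    using assms(2) l that by (metis nth_map)
  moreover have "c - s < length x" if "c \<in> set (U (length x))" "\<not> c < s" for c
    using param_space_set[OF assms(1), of "length x"] that by auto
  ultimately show ?thesis by (simp add: apply_word_def subst_word_def l)
qed

text \<open>Before the first difference of the projections the two words agree only after
  \<open>f\<close>, as do their images by \<open>map_apply_word_cong\<close>;
  \<open>apply_word_Cons\<close> then shows the deciding letters.\<close>

lemma map_apply_word_less:
  fixes f :: "nat \<Rightarrow> 'a::linorder"
  assumes U: "param_space s U" and less: "map f x < map f y"
  shows "map f (apply_word s U x) < map f (apply_word s U y)"
  using less
proof (cases rule: list_less_cases)
  case (prefix b r)
  then obtain p b' r' where y: "y = p @ b' # r'" "map f p = map f x" 
    by (auto simp: map_eq_append_conv map_eq_Cons_conv)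
  obtain z where "apply_word s U y = apply_word s U p @ b' # z" unfolding y(1) using apply_word_Cons[OF U] .
  then show ?thesis using map_apply_word_cong[OF U y(2)] by (simp add: less_append_Cons)
next
  case (differ p a b r r')
  then obtain p1 a' r1 p2 b' r2 where xy: "x = p1 @ a' # r1" "y = p2 @ b' # r2" "map f p1 = p" "map f p2 = p"
      "f a' = a" "f b' = b"
    by (auto simp: map_eq_append_conv map_eq_Cons_conv)
  obtain z where z: "apply_word s U x = apply_word s U p1 @ a' # z" unfolding xy(1) using apply_word_Cons[OF U] .
  obtain z' where z': "apply_word s U y = apply_word s U p2 @ b' # z'" unfolding xy(2) using apply_word_Cons[OF U] .
  have "map f (apply_word s U p1) = map f (apply_word s U p2)" by (rule map_apply_word_cong[OF U]) (simp add: xy)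
  then show ?thesis using differ(3) unfolding z z' by (simp add: xy append_Cons_less_append_Cons)
qed

lemma map_apply_word_le_iff:
  fixes f :: "nat \<Rightarrow> 'a::linorder"
  assumes U: "param_space s U"
  shows "map f (apply_word s U x) \<le> map f (apply_word s U y) \<longleftrightarrow> map f x \<le> map f y"
proof (cases "map f x" "map f y" rule: linorder_cases)
  case less
  then show ?thesis using map_apply_word_less[OF U less] by (simp add: less_imp_le)
next
  case equal
  then show ?thesis using map_apply_word_cong[OF U equal] by simp
next
  case greater
  then show ?thesis using map_apply_word_less[OF U greater] by (simp add: not_le[symmetric])
qed

definition hi :: "nat list \<Rightarrow> nat list" where "hi = map (\<lambda>a. a div 2)"
definition lo :: "nat list \<Rightarrow> nat list" where "lo = map (\<lambda>a. a mod 2)"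

lemma hi_lo_inject: "hi x = hi y \<Longrightarrow> lo x = lo y \<Longrightarrow> x = y"
proof (induction x arbitrary: y)
  case (Cons a x)
  then obtain b y' where y: "y = b # y'" by (cases y) (auto simp: hi_def)
  have "a div 2 = b div 2" "a mod 2 = b mod 2" using Cons.prems by (auto simp: y hi_def lo_def)
  then have "a = b" by (metis div_mult_mod_eq)
  then show ?case using Cons by (auto simp: y hi_def lo_def)
qed (auto simp: hi_def)

text \<open>The letters \<open>0, 1, 2, 3\<close> encode pairs of bits.\<close>

definition words :: "nat list binstr" where
  "words = Binstr {x. set x \<subseteq> {..<4}}
     {(x, y). set x \<subseteq> {..<4} \<and> set y \<subseteq> {..<4} \<and> hi x \<le> hi y \<and> lo x \<le> lo y}"

lemma univ_words: "x \<in> univ words \<longleftrightarrow> set x \<subseteq> {..<4}"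
  and rel_words: "(x, y) \<in> rel words \<longleftrightarrow> x \<in> univ words \<and> y \<in> univ words \<and> hi x \<le> hi y \<and> lo x \<le> lo y"
  by (auto simp: words_def)

section \<open>Embeddings between structures and words\<close>

lemma Emb_D:
  assumes "f \<in> Emb A B"
  shows "x \<in> univ A \<Longrightarrow> f x \<in> univ B" "inj_on f (univ A)"
    "x \<in> univ A \<Longrightarrow> y \<in> univ A \<Longrightarrow> (f x, f y) \<in> rel B \<longleftrightarrow> (x, y) \<in> rel A"
    "f \<in> extensional (univ A)"
  using assms by (auto simp: Emb_def PiE_def)

lemma EmbI:
  assumes "\<And>x. x \<in> univ A \<Longrightarrow> f x \<in> univ B" "inj_on f (univ A)"
    "\<And>x y. x \<in> univ A \<Longrightarrow> y \<in> univ A \<Longrightarrow> (f x, f y) \<in> rel B \<longleftrightarrow> (x, y) \<in> rel A"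
  shows "restrict f (univ A) \<in> Emb A B"
  using assms by (auto simp: Emb_def inj_on_def)

lemma Emb_compose: "f \<in> Emb A B \<Longrightarrow> g \<in> Emb B C \<Longrightarrow> (\<lambda>x\<in>univ A. g (f x)) \<in> Emb A C"
  by (rule EmbI) (auto simp: Emb_D inj_on_def dest: inj_onD[OF Emb_D(2)])

lemma Emb_apply_word:
  assumes U: "param_space 4 U"
  shows "restrict (apply_word 4 U) (univ words) \<in> Emb words words"
proof (rule EmbI)
  show w: "apply_word 4 U x \<in> univ words" if "x \<in> univ words" for x
    using that set_apply_word[OF U, of x 4] by (simp add: univ_words)
  show "(apply_word 4 U x, apply_word 4 U y) \<in> rel words \<longleftrightarrow> (x, y) \<in> rel words" if "x \<in> univ words" "y \<in> univ words" for x y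
    using that w by (simp add: rel_words hi_def lo_def map_apply_word_le_iff[OF U])
  show "inj_on (apply_word 4 U) (univ words)"
  proof (rule inj_onI)
    fix x y assume "apply_word 4 U x = apply_word 4 U y"
    then have "hi x \<le> hi y" "hi y \<le> hi x" "lo x \<le> lo y" "lo y \<le> lo x"
      unfolding hi_def lo_def by (simp_all add: map_apply_word_le_iff[OF U, symmetric])
    then show "x = y" using hi_lo_inject by auto
  qed
qed

text \<open>A copy \<open>e\<close> of the finite structure becomes the tuple of the words
  \<open>\<psi> (e x)\<close>. The self-embedding \<open>w\<close> goes into the words by
  \<open>\<psi>\<close>, through \<open>U\<close>, and back by \<open>\<theta>\<close>, so the
  colour of \<open>w\<close> after \<open>e\<close> can be read off the image of this tuple under
  \<open>U\<close>.\<close>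

lemma finite_big_ramsey_degrees_if_bi_embeddable_words:
  fixes \<Omega> :: "nat binstr"
  assumes \<psi>: "\<psi> \<in> Emb \<Omega> words" and \<theta>: "\<theta> \<in> Emb words \<Omega>"
  shows "finite_big_ramsey_degrees \<Omega>"
  unfolding finite_big_ramsey_degrees_def
proof (intro allI impI)
  fix S assume S: "S \<subseteq> univ \<Omega>" "finite S"
  obtain sl where sl: "set sl = S" using finite_list[OF S(2)] by blast
  define A where "A = induced \<Omega> S"
  have univA: "univ A = S" by (simp add: A_def induced_def)
  obtain t where t: "t > 0" "\<And>\<phi> :: nat list list \<Rightarrow> nat. finite (range \<phi>) \<Longrightarrow> \<exists>U. param_space 4 U \<and>
      card (\<phi> ` {map (apply_word 4 U) xs | xs. length xs = length sl \<and> (\<forall>x\<in>set xs. set x \<subseteq> {..<4})}) \<le> t"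
    using word_tuple_ramsey[where n = "length sl" and s = 4 and 'c = nat] by blast
  have "ramsey_bound A \<Omega> t"
    unfolding ramsey_bound_def
  proof (intro allI impI ballI)
    fix k :: nat and c assume k: "k > 0" and c: "c \<in> Emb A \<Omega> \<rightarrow> {0..<k}"
    define dec where "dec ys = (\<lambda>x\<in>S. \<theta> (the (map_of (zip sl ys) x)))" for ys
    have dec: "dec (map h sl) = (\<lambda>x\<in>S. \<theta> (h x))" for h
      unfolding dec_def using sl by (intro restrict_ext) (simp add: map_of_zip_map)
    \<comment> \<open>Tuples that do not decode to an embedding get the colour 0, a legal one
      because \<open>k > 0\<close>.\<close>
    define \<phi> where "\<phi> ys = (if dec ys \<in> Emb A \<Omega> then c (dec ys) else 0)" for ys
    have "range \<phi> \<subseteq> {0..<k}" using c k by (auto simp: \<phi>_def)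
    then have fin: "finite (range \<phi>)" by (rule finite_subset) simp
    obtain U where U: "param_space 4 U"
      "card (\<phi> ` {map (apply_word 4 U) xs | xs. length xs = length sl \<and> (\<forall>x\<in>set xs. set x \<subseteq> {..<4})}) \<le> t"
      using t(2)[OF fin] by blast
    define v where "v = (\<lambda>x\<in>univ \<Omega>. (restrict (apply_word 4 U) (univ words)) (\<psi> x))"
    define w where "w = (\<lambda>x\<in>univ \<Omega>. \<theta> (v x))"
    have "v \<in> Emb \<Omega> words" unfolding v_def by (rule Emb_compose[OF \<psi> Emb_apply_word[OF U(1)]])
    then have w: "w \<in> Emb \<Omega> \<Omega>" unfolding w_def by (rule Emb_compose[OF _ \<theta>])
    have wx: "w x = \<theta> (apply_word 4 U (\<psi> x))" if "x \<in> univ \<Omega>" for x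
      using that Emb_D(1)[OF \<psi>] by (simp add: w_def v_def)
    have "c ` (compose (univ A) w ` Emb A \<Omega>) \<subseteq>
      \<phi> ` {map (apply_word 4 U) xs | xs. length xs = length sl \<and> (\<forall>x\<in>set xs. set x \<subseteq> {..<4})}"
    proof (rule subsetI)
      fix d assume "d \<in> c ` (compose (univ A) w ` Emb A \<Omega>)"
      then obtain e where e: "e \<in> Emb A \<Omega>" and d: "d = c (compose S w e)" by (auto simp: univA)
      define xs where "xs = map (\<lambda>x. \<psi> (e x)) sl"
      have eS: "e x \<in> univ \<Omega>" if "x \<in> S" for x using Emb_D(1)[OF e] that by (simp add: univA)
      have "compose S w e = (\<lambda>x\<in>S. \<theta> (apply_word 4 U (\<psi> (e x))))"
        unfolding compose_def by (rule restrict_ext) (simp add: wx eS)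
      then have ce: "compose S w e = dec (map (apply_word 4 U) xs)"
        unfolding xs_def map_map o_def dec .
      have "compose S w e \<in> Emb A \<Omega>"
        using Emb_compose[OF e w] by (simp add: compose_def univA)
      then have "d = \<phi> (map (apply_word 4 U) xs)" by (simp add: \<phi>_def d ce)
      moreover have "\<forall>x\<in>set xs. set x \<subseteq> {..<4}" "length xs = length sl"
        using Emb_D(1)[OF \<psi>] eS sl unfolding xs_def by (auto simp: univ_words)
      ultimately show "d \<in> \<phi> ` {map (apply_word 4 U) xs | xs. length xs = length sl \<and> (\<forall>x\<in>set xs. set x \<subseteq> {..<4})}"
        by blast
    qed
    then have "card (c ` (compose (univ A) w ` Emb A \<Omega>)) \<le>
      card (\<phi> ` {map (apply_word 4 U) xs | xs. length xs = length sl \<and> (\<forall>x\<in>set xs. set x \<subseteq> {..<4})})"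
      by (rule card_mono[rotated]) (rule finite_subset[OF _ fin], blast)
    then show "\<exists>w\<in>Emb \<Omega> \<Omega>. card (c ` (compose (univ A) w ` Emb A \<Omega>)) \<le> t"
      using w U(2) by (intro bexI[OF _ w]) linarith
  qed
  then have "\<exists>t>0. ramsey_bound A \<Omega> t" using t(1) by blast
  then show "big_ramsey_degree (induced \<Omega> S) \<Omega> < \<infinity>"
    by (simp add: big_ramsey_degree_def A_def)
qed

text \<open>The word of \<open>n\<close> records which \<open>i < n\<close> lie below \<open>n\<close>; the final \<open>1\<close> decides the comparison of \<open>m\<close>
  and \<open>n\<close> when no smaller number separates them.\<close>

definition below_word :: "(nat \<times> nat) set \<Rightarrow> nat \<Rightarrow> nat list" where
  "below_word l n = map (\<lambda>i. if (i, n) \<in> l then 1 else 0) [0..<n] @ [1]"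

lemma list_less_nthI:
  fixes x y :: "'a::linorder list"
  assumes "j \<le> length x" "j < length y" "\<And>i. i < j \<Longrightarrow> x ! i = y ! i" "j < length x \<Longrightarrow> x ! j < y ! j"
  shows "x < y"
proof -
  have "take j x = take j y" using assms(1-3) by (intro nth_equalityI) auto
  moreover have y: "y = take j y @ y ! j # drop (Suc j) y" using assms(2) by (rule id_take_nth_drop)
  ultimately show ?thesis
  proof (cases "j < length x")
    case True
    then have "x = take j x @ x ! j # drop (Suc j) x" by (rule id_take_nth_drop)
    then show ?thesis using y \<open>take j x = take j y\<close> assms(4)[OF True] append_Cons_less_append_Cons by metis
  next
    case False
    then have "x = take j y" using \<open>take j x = take j y\<close> by simp
    then show ?thesis using y less_append_Cons by metis
  qed
qed

text \<open>At a first difference before both ends, some \<open>i\<close> is below just one of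
  \<open>m\<close> and \<open>n\<close>, and by transitivity this is \<open>n\<close>. Without such
  a difference, \<open>m < n\<close> makes one word a proper prefix of the other, as the final 1 of
  \<open>m\<close> matches the entry for \<open>m\<close> below \<open>n\<close>; and
  \<open>n < m\<close> opposes an entry 0 to the final 1 of \<open>n\<close>.\<close>

lemma below_word_less:
  assumes l: "linear_order_on V l" and mn: "(m, n) \<in> l" "m \<noteq> n"
  shows "below_word l m < below_word l n"
proof -
  have tr: "trans l" and as: "antisym l" and lV: "l \<subseteq> V \<times> V"
    using l by (auto simp: order_on_defs)
  have rf: "(m, m) \<in> l" "(n, n) \<in> l" using l mn lV by (auto simp: order_on_defs refl_on_def)
  have nth: "below_word l k ! i = (if i < k then (if (i, k) \<in> l then 1 else 0) else 1)" if "i \<le> k" for i k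
    using that by (auto simp: below_word_def nth_append)
  have len: "length (below_word l k) = Suc k" for k by (simp add: below_word_def)
  define D where "D i \<longleftrightarrow> below_word l m ! i \<noteq> below_word l n ! i" for i
  show ?thesis
  proof (cases "\<exists>i<min m n. D i")
    case True
    define j where "j = (LEAST i. i < min m n \<and> D i)"
    have j: "j < min m n" "D j" using LeastI_ex[OF True] by (auto simp: j_def)
    have "\<not> D i" if "i < j" for i using not_less_Least[of i "\<lambda>i. i < min m n \<and> D i"] that j(1) by (auto simp: j_def)
    moreover have "below_word l m ! j < below_word l n ! j"
      using j nth[of j m] nth[of j n] mn(1) tr by (auto simp: D_def split: if_splits dest: transD)
    ultimately show ?thesis using j(1) by (intro list_less_nthI[of j]) (auto simp: len D_def)
  next
    case False
    then have eq: "below_word l m ! i = below_word l n ! i" if "i < min m n" for i using that by (auto simp: D_def)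
    show ?thesis
    proof (cases "m < n")
      case True
      show ?thesis
      proof (rule list_less_nthI[of "Suc m"])
        fix i assume "i < Suc m"
        then show "below_word l m ! i = below_word l n ! i"
          using True eq[of i] nth[of m m] nth[of m n] mn(1) by (cases "i = m") auto
      qed (use True in \<open>auto simp: len\<close>)
    next
      case False
      then have nm: "n < m" using mn(2) by simp
      have "(n, m) \<notin> l" using mn as by (meson antisymD)
      then have "below_word l m ! n < below_word l n ! n" using nth[of n n] nth[of n m] nm by simp
      then show ?thesis using eq nm by (intro list_less_nthI[of n]) (auto simp: len)
    qed
  qed
qed

lemma below_word_le_iff:
  assumes l: "linear_order_on V l" and "m \<in> V" "n \<in> V"
  shows "below_word l m \<le> below_word l n \<longleftrightarrow> (m, n) \<in> l"
proof (cases "m = n")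
  case True
  then show ?thesis using assms by (auto simp: order_on_defs refl_on_def)
next
  case False
  then consider "(m, n) \<in> l" | "(n, m) \<in> l" using assms by (auto simp: order_on_defs total_on_def)
  then show ?thesis
  proof cases
    case 1
    then show ?thesis using below_word_less[OF l 1 False] by simp
  next
    case 2
    then have "(m, n) \<notin> l" using l False by (auto simp: order_on_defs antisym_def)
    then show ?thesis using below_word_less[OF l 2] False by (simp add: not_le)
  qed
qed

lemma two_dim_embeds_words:
  fixes P :: "nat binstr"
  assumes l1: "linear_order_on (univ P) l1" and l2: "linear_order_on (univ P) l2" and P: "rel P = l1 \<inter> l2"
  shows "Emb P words \<noteq> {}"
proof -
  \<comment> \<open>The letter is twice the bit for \<open>l1\<close> plus the bit for
    \<open>l2\<close>; the final 3 supplies the final 1 in both projections.\<close>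
  define f where "f n = map (\<lambda>i. (if (i, n) \<in> l1 then 2 else 0) + (if (i, n) \<in> l2 then 1 else 0)) [0..<n] @ [3 :: nat]" for n :: nat
  have hi: "hi (f n) = below_word l1 n" and lo: "lo (f n) = below_word l2 n" for n
    by (auto simp: hi_def lo_def f_def below_word_def)
  have fw: "f n \<in> univ words" for n by (auto simp: univ_words f_def)
  have r: "(f m, f n) \<in> rel words \<longleftrightarrow> (m, n) \<in> rel P" if "m \<in> univ P" "n \<in> univ P" for m n
    using that by (simp add: rel_words fw hi lo below_word_le_iff[OF l1] below_word_le_iff[OF l2] P)
  have "restrict f (univ P) \<in> Emb P words"
  proof (rule EmbI)
    show "inj_on f (univ P)"
    proof (rule inj_onI)
      fix m n assume mn: "m \<in> univ P" "n \<in> univ P" "f m = f n"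
      then have "(m, n) \<in> l1" "(n, m) \<in> l1"
        using below_word_le_iff[OF l1] hi by (metis order_refl)+
      then show "m = n" using l1 by (auto simp: order_on_defs antisym_def)
    qed
  qed (use fw r in auto)
  then show ?thesis by blast
qed

section \<open>Realizers from product orders and from ultrafilter limits\<close>

lemma product_order_two_dim:
  fixes a :: "'x \<Rightarrow> 'a::linorder" and b :: "'x \<Rightarrow> 'b::linorder"
  assumes inj: "\<And>x y. x \<in> V \<Longrightarrow> y \<in> V \<Longrightarrow> a x = a y \<Longrightarrow> b x = b y \<Longrightarrow> x = y"
  obtains l1 l2 where "linear_order_on V l1" "linear_order_on V l2"
    "l1 \<inter> l2 = {(x, y). x \<in> V \<and> y \<in> V \<and> a x \<le> a y \<and> b x \<le> b y}"
proof
  \<comment> \<open>Ties in one coordinate are broken by the other, so both linear orders extend the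
    product order.\<close>
  define l1 where "l1 = {(x, y). x \<in> V \<and> y \<in> V \<and> (a x < a y \<or> a x = a y \<and> b x \<le> b y)}"
  define l2 where "l2 = {(x, y). x \<in> V \<and> y \<in> V \<and> (b x < b y \<or> b x = b y \<and> a x \<le> a y)}"
  show "linear_order_on V l1"
    unfolding l1_def order_on_defs refl_on_def trans_def antisym_def total_on_def using inj by force
  show "linear_order_on V l2"
    unfolding l2_def order_on_defs refl_on_def trans_def antisym_def total_on_def using inj by force
  show "l1 \<inter> l2 = {(x, y). x \<in> V \<and> y \<in> V \<and> a x \<le> a y \<and> b x \<le> b y}"
    unfolding l1_def l2_def by auto
qed

lemma topspace_structure_space:
  "topspace (structure_space \<K>) = {M. wf_binstr M \<and> univ M = UNIV \<and> Age M = \<K>}"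
  by (simp add: structure_space_def topspace_pullback_topology)

lemma induced_in_Age:
  assumes "S \<subseteq> univ M" "finite S"
  shows "induced M S \<in> Age M"
proof -
  have "restrict (\<lambda>x. x) (univ (induced M S)) \<in> Emb (induced M S) M"
    by (rule EmbI) (use assms in \<open>auto simp: induced_def\<close>)
  then show ?thesis using assms by (auto simp: Age_def wf_binstr_def induced_def)
qed

text \<open>The realizers of the finite restrictions need not extend each other. Their limit along a
  nonprincipal ultrafilter still realizes \<open>M\<close>, since each axiom and each instance of
  the relation concerns finitely many points.\<close>

lemma two_dim_if_finite_restrictions:
  fixes M :: "nat binstr"
  assumes "\<And>n. at_most_2_dim (induced M {..<n})" "univ M = UNIV"
  obtains l1 l2 where "linear_order_on UNIV l1" "linear_order_on UNIV l2" "rel M = l1 \<inter> l2"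
proof -
  have "\<exists>l1 l2. linear_order_on {..<n} l1 \<and> linear_order_on {..<n} l2 \<and> rel M \<inter> {..<n} \<times> {..<n} = l1 \<inter> l2" for n
    using assms(1)[of n] by (simp add: at_most_2_dim_def induced_def)
  then obtain l1 l2 where l: "\<And>n. linear_order_on {..<n} (l1 n)" "\<And>n. linear_order_on {..<n} (l2 n)"
    "\<And>n. rel M \<inter> {..<n} \<times> {..<n} = l1 n \<inter> l2 n" by metis
  obtain p where p: "\<And>n::nat. ultrafilter_on {n..} p" using nonprincipal_ultrafilter by blast
  have eval_word: "p P" if "\<And>k. k \<ge> n \<Longrightarrow> P k" for P and n
    using ultrafilter_on_mono[OF p[of n] ultrafilter_on_carrier[OF p[of n]]] that by simp
  define L where "L l = {(x, y). p (\<lambda>n. (x, y) \<in> l n)}" for l :: "nat \<Rightarrow> (nat \<times> nat) set"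
  have lin: "linear_order_on UNIV (L l)" if l: "\<And>n. linear_order_on {..<n} (l n)" for l :: "nat \<Rightarrow> (nat \<times> nat) set"
    unfolding order_on_defs
  proof (intro conjI)
    show "refl_on UNIV (L l)"
      unfolding refl_on_def L_def
    proof clarsimp
      fix x show "p (\<lambda>n. (x, x) \<in> l n)"
        by (rule eval_word[of "Suc x"]) (use l in \<open>auto simp: order_on_defs refl_on_def\<close>)
    qed
    show "trans (L l)"
    proof (rule transI)
      fix x y z assume "(x, y) \<in> L l" "(y, z) \<in> L l"
      then have "p (\<lambda>n. (x, y) \<in> l n \<and> (y, z) \<in> l n)"
        unfolding L_def by (simp add: ultrafilter_on_conj[OF p])
      then have "p (\<lambda>n. (x, z) \<in> l n)"
        by (rule ultrafilter_on_mono[OF p[of 0]]) (use l in \<open>auto simp: order_on_defs dest: transD\<close>)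
      then show "(x, z) \<in> L l" by (simp add: L_def)
    qed
    show "antisym (L l)"
    proof (rule antisymI)
      fix x y assume "(x, y) \<in> L l" "(y, x) \<in> L l"
      then have "p (\<lambda>n. (x, y) \<in> l n \<and> (y, x) \<in> l n)"
        unfolding L_def by (simp add: ultrafilter_on_conj[OF p])
      then obtain n where "(x, y) \<in> l n \<and> (y, x) \<in> l n" by (rule ultrafilter_on_ex[OF p[of 0]])
      then show "x = y" using l[of n] by (auto simp: order_on_defs antisym_def)
    qed
    show "total_on UNIV (L l)"
    proof (rule total_onI)
      fix x y :: nat assume "x \<noteq> y"
      have "p (\<lambda>n. (x, y) \<in> l n \<or> (y, x) \<in> l n)"
        by (rule eval_word[of "Suc (max x y)"]) (use l \<open>x \<noteq> y\<close> in \<open>auto simp: order_on_defs total_on_def\<close>)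
      then show "(x, y) \<in> L l \<or> (y, x) \<in> L l"
        unfolding L_def by (simp add: ultrafilter_on_disj[OF p])
    qed
  qed simp
  have "rel M = L l1 \<inter> L l2"
  proof -
    have "(x, y) \<in> rel M \<longleftrightarrow> p (\<lambda>n. (x, y) \<in> l1 n \<and> (x, y) \<in> l2 n)" for x y
    proof -
      have *: "(x, y) \<in> rel M \<longleftrightarrow> (x, y) \<in> l1 n \<and> (x, y) \<in> l2 n" if "n \<ge> Suc (max x y)" for n
      proof -
        have "(x, y) \<in> {..<n} \<times> {..<n}" using that by auto
        then show ?thesis using l(3)[of n] by blast
      qed
      show ?thesis
      proof (cases "(x, y) \<in> rel M")
        case True
        then show ?thesis using eval_word[of "Suc (max x y)"] * by simp
      next
        case False
        then have "p (\<lambda>n. \<not> ((x, y) \<in> l1 n \<and> (x, y) \<in> l2 n))" using * by (intro eval_word[of "Suc (max x y)"]) simp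
        then show ?thesis using False by (simp only: ultrafilter_on_not[OF p] simp_thms)
      qed
    qed
    then show ?thesis by (auto simp: L_def ultrafilter_on_conj[OF p])
  qed
  then show ?thesis using lin l by (intro that[of "L l1" "L l2"]) auto
qed

lemma generic_embeds_words:
  assumes "\<Omega> \<in> topspace (structure_space K2)"
  shows "Emb \<Omega> words \<noteq> {}"
proof -
  have \<Omega>: "univ \<Omega> = UNIV" "Age \<Omega> = K2" using assms by (simp_all add: topspace_structure_space)
  have "at_most_2_dim (induced \<Omega> {..<n})" for n
    using induced_in_Age[of "{..<n}" \<Omega>] \<Omega> by (simp add: K2_def)
  then obtain l1 l2 where "linear_order_on UNIV l1" "linear_order_on UNIV l2" "rel \<Omega> = l1 \<inter> l2"
    by (rule two_dim_if_finite_restrictions[OF _ \<Omega>(1)])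
  then show ?thesis using two_dim_embeds_words[of \<Omega>] \<Omega>(1) by simp
qed

section \<open>Structures with age of at most 2-dimensional posets\<close>

lemma linear_order_on_D:
  assumes "linear_order_on V l"
  shows "x \<in> V \<Longrightarrow> y \<in> V \<Longrightarrow> (x, y) \<in> l \<or> (y, x) \<in> l"
    and "(x, y) \<in> l \<Longrightarrow> (y, z) \<in> l \<Longrightarrow> (x, z) \<in> l"
    and "(x, y) \<in> l \<Longrightarrow> (y, x) \<in> l \<Longrightarrow> x = y"
    and "x \<in> V \<Longrightarrow> (x, x) \<in> l" and "l \<subseteq> V \<times> V"
proof -
  have l: "refl_on V l" "trans l" "antisym l" "total_on V l" and sub: "l \<subseteq> V \<times> V"
    using assms by (simp_all add: order_on_defs)
  show rf: "x \<in> V \<Longrightarrow> (x, x) \<in> l" for x using l(1) by (simp add: refl_on_def)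
  show "x \<in> V \<Longrightarrow> y \<in> V \<Longrightarrow> (x, y) \<in> l \<or> (y, x) \<in> l"
    using l(4) rf by (cases "x = y") (simp_all add: total_on_def)
  show "(x, y) \<in> l \<Longrightarrow> (y, z) \<in> l \<Longrightarrow> (x, z) \<in> l" by (rule transD[OF l(2)])
  show "(x, y) \<in> l \<Longrightarrow> (y, x) \<in> l \<Longrightarrow> x = y" by (rule antisymD[OF l(3)])
  show "l \<subseteq> V \<times> V" by (rule sub)
qed

lemma at_most_2_dimI:
  assumes "linear_order_on (univ P) l1" "linear_order_on (univ P) l2" "rel P = l1 \<inter> l2"
  shows "at_most_2_dim P"
proof -
  have "partial_order_on (univ P) (rel P)"
    using assms by (auto simp: order_on_defs refl_on_def intro: trans_Int antisym_subset)
  then show ?thesis using assms by (auto simp: at_most_2_dim_def)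
qed

lemma at_most_2_dimE:
  assumes "at_most_2_dim P"
  obtains l1 l2 where "linear_order_on (univ P) l1" "linear_order_on (univ P) l2" "rel P = l1 \<inter> l2"
  using assms by (auto simp: at_most_2_dim_def)

lemma at_most_2_dim_wf: "at_most_2_dim P \<Longrightarrow> wf_binstr P"
  by (auto simp: at_most_2_dim_def wf_binstr_def order_on_defs)

lemma at_most_2_dim_product_order:
  fixes a :: "'x \<Rightarrow> 'a::linorder" and b :: "'x \<Rightarrow> 'b::linorder"
  assumes "\<And>x y. x \<in> V \<Longrightarrow> y \<in> V \<Longrightarrow> a x = a y \<Longrightarrow> b x = b y \<Longrightarrow> x = y"
  shows "at_most_2_dim (Binstr V {(x, y). x \<in> V \<and> y \<in> V \<and> a x \<le> a y \<and> b x \<le> b y})"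
proof -
  obtain l1 l2 where "linear_order_on V l1" "linear_order_on V l2"
    "l1 \<inter> l2 = {(x, y). x \<in> V \<and> y \<in> V \<and> a x \<le> a y \<and> b x \<le> b y}"
    using product_order_two_dim[of V a b] assms by blast
  then show ?thesis by (intro at_most_2_dimI[of _ l1 l2]) auto
qed

lemma at_most_2_dim_words: "at_most_2_dim words"
proof -
  have "words = Binstr (univ words) {(x, y). x \<in> univ words \<and> y \<in> univ words \<and> hi x \<le> hi y \<and> lo x \<le> lo y}"
    by (simp add: words_def)
  also have "at_most_2_dim \<dots>" by (rule at_most_2_dim_product_order) (rule hi_lo_inject)
  finally show ?thesis .
qed

lemma at_most_2_dim_pullback:
  assumes f: "f \<in> Emb A B" and B: "at_most_2_dim B" and A: "wf_binstr A"
  shows "at_most_2_dim A"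
proof -
  obtain l1 l2 where l: "linear_order_on (univ B) l1" "linear_order_on (univ B) l2" "rel B = l1 \<inter> l2"
    using B by (rule at_most_2_dimE)
  define pb where "pb l = {(x, y). x \<in> univ A \<and> y \<in> univ A \<and> (f x, f y) \<in> l}" for l
  have "linear_order_on (univ A) (pb l)" if l: "linear_order_on (univ B) l" for l
    unfolding order_on_defs
  proof (intro conjI)
    show "pb l \<subseteq> univ A \<times> univ A" by (auto simp: pb_def)
    show "refl_on (univ A) (pb l)" using l Emb_D(1)[OF f] by (auto simp: order_on_defs refl_on_def pb_def)
    show "trans (pb l)"
      by (rule transI) (use l in \<open>auto simp: order_on_defs pb_def dest: transD\<close>)
    show "antisym (pb l)"
      by (rule antisymI) (use l inj_onD[OF Emb_D(2)[OF f]] in \<open>auto simp: order_on_defs pb_def dest: antisymD\<close>)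
    show "total_on (univ A) (pb l)"
      by (rule total_onI) (use linear_order_on_D(1)[OF l] Emb_D(1)[OF f] in \<open>auto simp: pb_def\<close>)
  qed
  moreover have "rel A = pb l1 \<inter> pb l2"
    using A Emb_D(3)[OF f] by (auto simp: wf_binstr_def pb_def l(3))
  ultimately show ?thesis using l by (intro at_most_2_dimI[of _ "pb l1" "pb l2"]) auto
qed

section \<open>Copies of the words on the natural numbers and the topology of the structure
  space\<close>

lemma Age_words_copy:
  fixes M :: "nat binstr"
  assumes \<phi>: "bij_betw \<phi> UNIV (univ words)"
  defines "M \<equiv> Binstr UNIV {(i, j). (\<phi> i, \<phi> j) \<in> rel words}"
  shows "M \<in> topspace (structure_space K2)" "at_most_2_dim M" "Emb words M \<noteq> {}"
proof -
  have inj: "inj \<phi>" and ran: "\<phi> i \<in> univ words" for i using \<phi> by (auto simp: bij_betw_def)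
  have "restrict \<phi> (univ M) \<in> Emb M words"
    by (rule EmbI) (auto simp: M_def ran inj)
  moreover have "restrict \<phi> (univ M) = \<phi>" by (auto simp: M_def restrict_def)
  ultimately have e: "\<phi> \<in> Emb M words" by simp
  show dim: "at_most_2_dim M"
    by (rule at_most_2_dim_pullback[OF e at_most_2_dim_words]) (simp add: wf_binstr_def M_def)
  define \<psi> where "\<psi> = inv_into UNIV \<phi>"
  have \<psi>: "\<phi> (\<psi> x) = x" if "x \<in> univ words" for x
    using that \<phi> by (auto simp: \<psi>_def bij_betw_def f_inv_into_f)
  have e': "restrict \<psi> (univ words) \<in> Emb words M"
    by (rule EmbI) (auto simp: M_def \<psi> intro: inj_on_inverseI[where g = \<phi>])
  then show "Emb words M \<noteq> {}" by blast
  have "Age M = K2"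
  proof (intro equalityI subsetI)
    fix P assume "P \<in> Age M"
    then show "P \<in> K2" using at_most_2_dim_pullback[OF _ dim] by (auto simp: Age_def K2_def)
  next
    fix P assume P: "P \<in> K2"
    then obtain l1 l2 where "linear_order_on (univ P) l1" "linear_order_on (univ P) l2" "rel P = l1 \<inter> l2"
      by (auto simp: K2_def elim: at_most_2_dimE)
    then obtain g where "g \<in> Emb P words" using two_dim_embeds_words by blast
    then have "Emb P M \<noteq> {}" using Emb_compose[OF _ e'] by blast
    then show "P \<in> Age M" using P at_most_2_dim_wf by (auto simp: Age_def K2_def)
  qed
  then show "M \<in> topspace (structure_space K2)"
    by (simp add: topspace_structure_space M_def wf_binstr_def)
qed

lemma infinite_words: "infinite (univ words)"
proof
  assume "finite (univ words)"
  moreover have "range (\<lambda>n. replicate n 0) \<subseteq> univ words" by (auto simp: univ_words)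
  ultimately have "finite (range (\<lambda>n. replicate n (0::nat)))" by (rule rev_finite_subset)
  moreover have "inj (\<lambda>n. replicate n (0::nat))" by (rule injI) simp
  ultimately show False using finite_imageD by blast
qed

text \<open>\<open>A\<close> is embedded into the words, and the remaining words are enumerated from
  \<open>n\<close> on. This makes every basic open set given by such an \<open>A\<close>
  nonempty.\<close>

lemma structure_extending:
  fixes A :: "nat binstr"
  assumes A: "at_most_2_dim A" "univ A = {..<n}"
  obtains M where "M \<in> topspace (structure_space K2)" "induced M {..<n} = A"
proof -
  obtain l1 l2 where "linear_order_on (univ A) l1" "linear_order_on (univ A) l2" "rel A = l1 \<inter> l2"
    using A(1) by (rule at_most_2_dimE)
  then obtain e where e: "e \<in> Emb A words" using two_dim_embeds_words by blast
  define V where "V = univ words - e ` {..<n}"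
  have V: "bij_betw (from_nat_into V) UNIV V"
    by (rule bij_betw_from_nat_into) (auto simp: V_def infinite_words)
  define \<phi> where "\<phi> i = (if i < n then e i else from_nat_into V (i - n))" for i
  have "bij_betw \<phi> UNIV (univ words)"
    unfolding bij_betw_def
  proof
    have eV: "e i \<noteq> from_nat_into V j" if "i < n" for i j
      using V that by (auto simp: V_def bij_betw_def)
    show "inj \<phi>"
    proof (rule injI)
      fix i j assume ij: "\<phi> i = \<phi> j"
      show "i = j"
      proof (cases "i < n"; cases "j < n")
        assume "i < n" "j < n"
        then show ?thesis using ij Emb_D(2)[OF e] by (auto simp: \<phi>_def A(2) inj_on_def)
      next
        assume *: "\<not> i < n" "\<not> j < n"
        then have "i - n = j - n" using ij V by (auto simp: \<phi>_def bij_betw_def inj_on_def)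
        then show ?thesis using * by simp
      next
        assume *: "i < n" "\<not> j < n"
        then show ?thesis using ij eV[OF *(1), of "j - n"] by (simp add: \<phi>_def)
      next
        assume *: "\<not> i < n" "j < n"
        then show ?thesis using ij eV[OF *(2), of "i - n"] by (simp add: \<phi>_def)
      qed
    qed
    show "range \<phi> = univ words"
    proof (intro equalityI subsetI)
      fix x assume "x \<in> range \<phi>"
      then show "x \<in> univ words" using Emb_D(1)[OF e] V by (auto simp: \<phi>_def A(2) bij_betw_def V_def)
    next
      fix x assume x: "x \<in> univ words"
      show "x \<in> range \<phi>"
      proof (cases "x \<in> V")
        case True
        then obtain j where "x = from_nat_into V j" using V by (auto simp: bij_betw_def)
        then show ?thesis by (intro image_eqI[of _ _ "n + j"]) (auto simp: \<phi>_def)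
      next
        case False
        then obtain i where "i < n" "x = e i" using x by (auto simp: V_def)
        then show ?thesis by (intro image_eqI[of _ _ i]) (auto simp: \<phi>_def)
      qed
    qed
  qed
  note M = Age_words_copy(1)[OF this]
  have "rel A \<subseteq> univ A \<times> univ A" using at_most_2_dim_wf[OF A(1)] by (simp add: wf_binstr_def)
  then have "induced (Binstr UNIV {(i, j). (\<phi> i, \<phi> j) \<in> rel words}) {..<n} = A"
    using Emb_D(3)[OF e] A(2) unfolding induced_def by (cases A) (auto simp: \<phi>_def)
  with M show ?thesis by (rule that)
qed

lemma open_contains_restriction:
  assumes W: "openin (structure_space \<K>) W" and M: "M \<in> W"
  obtains m where "\<And>M' k. M' \<in> topspace (structure_space \<K>) \<Longrightarrow> m \<le> k \<Longrightarrow>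
    induced M' {..<k} = induced M {..<k} \<Longrightarrow> M' \<in> W"
proof -
  define A where "A = {M :: nat binstr. wf_binstr M \<and> univ M = UNIV \<and> Age M = \<K>}"
  define T where "T = product_topology (\<lambda>_::nat \<times> nat. discrete_topology (UNIV :: bool set)) UNIV"
  obtain O' where O: "openin T O'" "W = (\<lambda>M p. p \<in> rel M) -` O' \<inter> A"
    using W unfolding structure_space_def openin_pullback_topology A_def T_def by blast
  have "(\<lambda>p. p \<in> rel M) \<in> O'" using M O(2) by simp
  then obtain U where U: "finite {p. U p \<noteq> UNIV}" "(\<lambda>p. p \<in> rel M) \<in> Pi\<^sub>E UNIV U" "Pi\<^sub>E UNIV U \<subseteq> O'"
    using O(1) unfolding T_def openin_product_topology_alt by auto
  obtain m where m: "\<And>p. U p \<noteq> UNIV \<Longrightarrow> fst p < m \<and> snd p < m"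
  proof -
    have "finite (fst ` {p. U p \<noteq> UNIV} \<union> snd ` {p. U p \<noteq> UNIV})" using U(1) by simp
    then obtain m where "\<forall>i\<in>fst ` {p. U p \<noteq> UNIV} \<union> snd ` {p. U p \<noteq> UNIV}. i < m"
      unfolding finite_nat_set_iff_bounded by blast
    then show ?thesis by (intro that[of m]) blast
  qed
  show ?thesis
  proof (rule that[of m])
    fix M' k assume M': "M' \<in> topspace (structure_space \<K>)" "m \<le> k" "induced M' {..<k} = induced M {..<k}"
    have eq: "p \<in> rel M' \<longleftrightarrow> p \<in> rel M" if "U p \<noteq> UNIV" for p
    proof -
      have "p \<in> {..<k} \<times> {..<k}" using m[OF that] M'(2) by (cases p) auto
      moreover have "rel M' \<inter> {..<k} \<times> {..<k} = rel M \<inter> {..<k} \<times> {..<k}"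
        using M'(3) by (simp add: induced_def)
      ultimately show ?thesis by blast
    qed
    have h: "(p \<in> rel M') \<in> U p" for p
    proof (cases "U p = UNIV")
      case False
      have "(p \<in> rel M) \<in> U p" by (rule PiE_mem[OF U(2)]) simp
      then show ?thesis using eq[OF False] by simp
    qed simp
    have "(\<lambda>p. p \<in> rel M') \<in> Pi\<^sub>E UNIV U" by (rule PiE_I) (rule h, simp)
    then have "(\<lambda>p. p \<in> rel M') \<in> O'" by (rule subsetD[OF U(3)])
    moreover have "M' \<in> A" using M'(1) by (simp add: topspace_structure_space A_def)
    ultimately show "M' \<in> W" using O(2) by simp
  qed
qed

lemma open_restriction:
  assumes "univ A = {..<m}"
  shows "openin (structure_space \<K>) {M \<in> topspace (structure_space \<K>). induced M {..<m} = A}"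
proof -
  define U where "U p = (if p \<in> {..<m} \<times> {..<m} then {p \<in> rel A} else UNIV)" for p
  define T where "T = product_topology (\<lambda>_::nat \<times> nat. discrete_topology (UNIV :: bool set)) UNIV"
  show ?thesis
  proof (cases "rel A \<subseteq> {..<m} \<times> {..<m}")
    case True
    have "openin T (Pi\<^sub>E UNIV U)"
      unfolding T_def
    proof (rule product_topology_basis)
      have "{p. U p \<noteq> UNIV} \<subseteq> {..<m} \<times> {..<m}" by (auto simp: U_def)
      then show "finite {i. U i \<noteq> topspace (discrete_topology UNIV)}" by (simp add: finite_subset)
    qed simp
    moreover have "{M \<in> topspace (structure_space \<K>). induced M {..<m} = A} =
      (\<lambda>M p. p \<in> rel M) -` Pi\<^sub>E UNIV U \<inter> {M. wf_binstr M \<and> univ M = UNIV \<and> Age M = \<K>}"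
    proof -
      have "induced M {..<m} = A \<longleftrightarrow> (\<lambda>p. p \<in> rel M) \<in> Pi\<^sub>E UNIV U" for M
      proof -
        have "induced M {..<m} = A \<longleftrightarrow> rel M \<inter> {..<m} \<times> {..<m} = rel A"
          using assms by (cases A) (auto simp: induced_def)
        also have "\<dots> \<longleftrightarrow> (\<forall>p\<in>{..<m} \<times> {..<m}. p \<in> rel M \<longleftrightarrow> p \<in> rel A)" using True by blast
        also have "\<dots> \<longleftrightarrow> (\<forall>p. (p \<in> rel M) \<in> U p)" unfolding U_def by (auto split: if_splits)
        finally show ?thesis by (simp add: PiE_iff)
      qed
      then show ?thesis by (auto simp: topspace_structure_space)
    qed
    ultimately show ?thesis unfolding structure_space_def openin_pullback_topology T_def[symmetric] by blast
  next
    case False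
    then have "induced M {..<m} \<noteq> A" for M by (auto simp: induced_def)
    then show ?thesis by simp
  qed
qed

lemma induced_induced: "m \<le> k \<Longrightarrow> induced (induced M {..<k}) {..<m} = induced M {..<m :: nat}"
  by (auto simp: induced_def)

text \<open>The open set given by \<open>A\<close> is nonempty and so not contained in the closure
  of \<open>N\<close>. A point outside the closure has a basic neighbourhood outside it, and a long
  enough restriction of this point is \<open>A'\<close>.\<close>

lemma avoid_nowhere_dense:
  fixes A :: "nat binstr"
  assumes N: "nowhere_dense_in (structure_space K2) N"
    and A: "at_most_2_dim A" "univ A = {..<m}"
  obtains m' A' where "m \<le> m'" "at_most_2_dim A'" "univ A' = {..<m'}" "induced A' {..<m} = A"
    "\<And>M. M \<in> topspace (structure_space K2) \<Longrightarrow> induced M {..<m'} = A' \<Longrightarrow> M \<notin> N"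
proof -
  define X where "X = structure_space K2"
  define C where "C = {M \<in> topspace X. induced M {..<m} = A}"
  have opC: "openin X C" unfolding C_def X_def by (rule open_restriction) (rule A)
  have "\<not> C \<subseteq> X closure_of N"
  proof
    assume "C \<subseteq> X closure_of N"
    then have "C \<subseteq> X interior_of (X closure_of N)" using opC by (rule interior_of_maximal)
    then have "C = {}" using N by (simp add: nowhere_dense_in_def X_def)
    then show False using structure_extending[OF A] by (auto simp: C_def X_def)
  qed
  then obtain M where M: "M \<in> C" "M \<notin> X closure_of N" by blast
  define W where "W = C - X closure_of N"
  have "openin X W" unfolding W_def by (rule openin_diff[OF opC]) simp
  then obtain m0 where m0: "\<And>M' k. M' \<in> topspace X \<Longrightarrow> m0 \<le> k \<Longrightarrow>
    induced M' {..<k} = induced M {..<k} \<Longrightarrow> M' \<in> W"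
    using open_contains_restriction[of K2 W M] M unfolding X_def W_def by blast
  have MX: "univ M = UNIV" "Age M = K2" using M(1) by (auto simp: C_def X_def topspace_structure_space)
  define k where "k = max m m0"
  have NX: "N \<subseteq> X closure_of N" using N by (intro closure_of_subset) (simp add: nowhere_dense_in_def X_def)
  show ?thesis
  proof (rule that[of k "induced M {..<k}"])
    show "at_most_2_dim (induced M {..<k})"
      using induced_in_Age[of "{..<k}" M] MX by (simp add: K2_def)
    show "induced (induced M {..<k}) {..<m} = A"
      using M(1) by (simp add: induced_induced k_def C_def)
    show "M' \<notin> N" if "M' \<in> topspace (structure_space K2)" "induced M' {..<k} = induced M {..<k}" for M'
      using m0[of M' k] that NX by (auto simp: X_def W_def k_def)
  qed (auto simp: induced_def k_def)
qed

section \<open>Finite posets in the real plane and their frames\<close>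

lemma strict_mono_extension:
  fixes g :: "real \<Rightarrow> real"
  assumes "finite F" "\<And>x y. x \<in> F \<Longrightarrow> y \<in> F \<Longrightarrow> x < y \<Longrightarrow> g x < g y"
  obtains h where "strict_mono h" "\<And>x. x \<in> F \<Longrightarrow> h x = g x"
proof -
  have "\<exists>h. strict_mono h \<and> (\<forall>x\<in>F. h x = g x)"
    using assms
  proof (induction F rule: finite_linorder_max_induct)
    case empty
    then show ?case by (intro exI[of _ "\<lambda>x. x"]) (auto simp: strict_mono_def)
  next
    case (insert b F)
    then obtain h where h: "strict_mono h" "\<forall>x\<in>F. h x = g x" by blast
    show ?case
    proof (cases "F = {}")
      case True
      then show ?thesis by (intro exI[of _ "\<lambda>x. x + (g b - b)"]) (auto simp: strict_mono_def)
    next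
      case False
      define c where "c = Max F"
      have c: "c \<in> F" "\<And>x. x \<in> F \<Longrightarrow> x \<le> c" using False insert.hyps by (auto simp: c_def)
      have cb: "c < b" "g c < g b" using c(1) insert by auto
      define d where "d = (g b - g c) / (b - c)"
      have d: "d > 0" using cb by (simp add: d_def)
      \<comment> \<open>Beyond the old maximum \<open>c\<close> the map continues along the line
        through \<open>g c\<close> and \<open>g b\<close>.\<close>
      define h' where "h' x = (if x \<le> c then h x else g c + (x - c) * d)" for x
      have hc: "h c = g c" using h c by auto
      have "strict_mono h'"
      proof (rule strict_monoI)
        fix x y :: real assume xy: "x < y"
        consider "y \<le> c" | "x \<le> c" "c < y" | "c < x" using xy by linarith
        then show "h' x < h' y"
        proof cases
          case 1
          then show ?thesis using xy h(1) by (auto simp: h'_def strict_mono_def)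
        next
          case 2
          have "h x \<le> h c" using h(1) 2 by (meson strict_mono_less_eq)
          moreover have "0 < (y - c) * d" using 2 d by simp
          ultimately show ?thesis using 2 hc by (simp add: h'_def)
        next
          case 3
          have "(x - c) * d < (y - c) * d" using xy d by simp
          then show ?thesis using 3 xy by (simp add: h'_def)
        qed
      qed
      moreover have "h' b = g b" using cb by (simp add: h'_def d_def)
      moreover have "h' x = g x" if "x \<in> F" for x using that c h by (simp add: h'_def)
      ultimately show ?thesis by (intro exI[of _ h']) auto
    qed
  qed
  then show ?thesis using that by blast
qed

definition rank_in :: "'a set \<Rightarrow> ('a \<times> 'a) set \<Rightarrow> 'a \<Rightarrow> real" where
  "rank_in V l x = real (card {y \<in> V. (y, x) \<in> l})"

lemma rank_in_le_iff:
  assumes "linear_order_on V' l" "finite V" "V \<subseteq> V'" "x \<in> V" "y \<in> V"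
  shows "rank_in V l x \<le> rank_in V l y \<longleftrightarrow> (x, y) \<in> l"
proof -
  have tr: "trans l" and as: "antisym l" and tot: "total_on V' l" and rf: "refl_on V' l"
    using assms(1) by (auto simp: order_on_defs)
  have le: "rank_in V l x \<le> rank_in V l y" if "(x, y) \<in> l" for x y
    unfolding rank_in_def of_nat_le_iff by (rule card_mono) (use assms(2) that tr in \<open>auto dest: transD\<close>)
  have less: "rank_in V l x < rank_in V l y" if "(x, y) \<in> l" "x \<noteq> y" "y \<in> V" for x y
    unfolding rank_in_def of_nat_less_iff
  proof (rule psubset_card_mono)
    have "(y, y) \<in> l" using rf that(3) assms(3) by (auto simp: refl_on_def)
    moreover have "(y, x) \<notin> l" using as that by (meson antisymD)
    ultimately show "{z \<in> V. (z, x) \<in> l} \<subset> {z \<in> V. (z, y) \<in> l}"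
      using that tr by (auto dest: transD)
  qed (use assms(2) in simp)
  show ?thesis
  proof
    assume "rank_in V l x \<le> rank_in V l y"
    then have "\<not> ((y, x) \<in> l \<and> y \<noteq> x)" using less[of y x] assms(4) by auto
    moreover have "(x, y) \<in> l \<or> (y, x) \<in> l" using linear_order_on_D(1)[OF assms(1)] assms(3-5) by blast
    ultimately show "(x, y) \<in> l" by blast
  qed (rule le)
qed

lemma rank_in_bounds:
  assumes "linear_order_on V' l" "finite V" "V \<subseteq> V'" "x \<in> V"
  shows "1 \<le> rank_in V l x" "rank_in V l x \<le> card V"
proof -
  have "x \<in> {y \<in> V. (y, x) \<in> l}" using assms linear_order_on_D(4)[OF assms(1), of x] by auto
  then have "card {y \<in> V. (y, x) \<in> l} > 0" using assms(2) by (auto simp: card_gt_0_iff)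
  then show "1 \<le> rank_in V l x" by (simp add: rank_in_def)
  show "rank_in V l x \<le> card V" unfolding rank_in_def using assms(2) by (auto intro!: card_mono)
qed

text \<open>\<open>Pt i\<close> are the base points, \<open>NW\<close> and \<open>SE\<close> two corners of the plane. \<open>Le i\<close> lies on the left edge
  and \<open>Ri i\<close> on the right edge, both in the horizontal gap just below \<open>Pt i\<close>.\<close>

datatype lab = NW | SE | Pt nat | Le nat | Ri nat

definition labs :: "nat \<Rightarrow> lab set" where
  "labs n = {NW, SE} \<union> Pt ` {..<n} \<union> Le ` {..<n} \<union> Ri ` {..<n}"

fun cx :: "(nat \<times> nat) set \<Rightarrow> nat \<Rightarrow> lab \<Rightarrow> real" where
  "cx R1 n NW = 0"
| "cx R1 n SE = real n + 1"
| "cx R1 n (Pt i) = rank_in {..<n} R1 i"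
| "cx R1 n (Le i) = 0"
| "cx R1 n (Ri i) = real n + 1"

text \<open>Ranks start at 1, and the factor 3 leaves two free levels below each base point.
  \<open>Le i\<close> takes the upper one, which makes it incomparable to \<open>Ri i\<close>;
  \<open>SE\<close> is below and \<open>NW\<close> above all other levels.\<close>

fun cy :: "(nat \<times> nat) set \<Rightarrow> nat \<Rightarrow> lab \<Rightarrow> real" where
  "cy R2 n NW = 3 * real n + 1"
| "cy R2 n SE = 0"
| "cy R2 n (Pt i) = 3 * rank_in {..<n} R2 i"
| "cy R2 n (Le i) = 3 * rank_in {..<n} R2 i - 1"
| "cy R2 n (Ri i) = 3 * rank_in {..<n} R2 i - 2"

text \<open>Only the relation of \<open>A\<close> is mentioned, so a frame survives every extension
  of \<open>A\<close>, whatever realizers the extension has.\<close>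

definition framed :: "(nat \<times> nat) set \<Rightarrow> (nat \<times> nat) set \<Rightarrow> nat \<Rightarrow> nat binstr \<Rightarrow> (lab \<Rightarrow> nat) \<Rightarrow> bool" where
  "framed R1 R2 n A f \<longleftrightarrow> (\<forall>x\<in>labs n. f x \<in> univ A) \<and>
     (\<forall>x\<in>labs n. \<forall>y\<in>labs n. (f x, f y) \<in> rel A \<longleftrightarrow> cx R1 n x \<le> cx R1 n y \<and> cy R2 n x \<le> cy R2 n y)"

text \<open>Gallai's forcing for transitive orientations of the incomparability graph. If
  \<open>a\<close> came strictly between \<open>c\<close> and \<open>b\<close> in \<open>l1\<close>,
  it would do so in the reverse direction in \<open>l2\<close>, and \<open>b\<close> and
  \<open>c\<close> would be incomparable.\<close>

lemma orientation_forcing: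
  assumes l1: "linear_order_on V l1" and l2: "linear_order_on V l2"
    and abc: "a \<in> V" "b \<in> V" "c \<in> V"
    and "(a, b) \<notin> l1 \<inter> l2" "(b, a) \<notin> l1 \<inter> l2" "(a, c) \<notin> l1 \<inter> l2" "(c, a) \<notin> l1 \<inter> l2"
    and "(b, c) \<in> l1 \<inter> l2 \<or> (c, b) \<in> l1 \<inter> l2"
    and "(a, b) \<in> l1"
  shows "(a, c) \<in> l1"
proof (rule ccontr)
  note D1 = linear_order_on_D[OF l1] and D2 = linear_order_on_D[OF l2]
  assume nac: "(a, c) \<notin> l1"
  then have ca: "(c, a) \<in> l1" using D1(1)[OF abc(1,3)] by blast
  then have ac: "(a, c) \<in> l2" using assms(9) D2(1)[OF abc(1,3)] by blast
  have ba: "(b, a) \<in> l2" using assms(6,11) D2(1)[OF abc(1,2)] by blast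
  have cb: "(c, b) \<in> l1" by (rule D1(2)[OF ca assms(11)])
  have bc: "(b, c) \<in> l2" by (rule D2(2)[OF ba ac])
  have "b = c" using assms(10) D1(3)[OF _ cb] D2(3)[OF bc] by blast
  then show False using assms(11) nac by simp
qed

section \<open>Rigid extensions and amalgamation\<close>

lemma rank_in_less_imp:
  assumes "rank_in V l x < rank_in V l y"
  shows "rank_in V l x + 1 \<le> rank_in V l y"
proof -
  have "Suc (card {z \<in> V. (z, x) \<in> l}) \<le> card {z \<in> V. (z, y) \<in> l}"
    using assms unfolding rank_in_def of_nat_less_iff by (rule Suc_leI)
  then have "real (Suc (card {z \<in> V. (z, x) \<in> l})) \<le> real (card {z \<in> V. (z, y) \<in> l})"
    by (simp only: of_nat_le_iff)
  then show ?thesis by (simp add: rank_in_def)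
qed

lemma rank_in_less_iff:
  assumes "linear_order_on V' l" "finite V" "V \<subseteq> V'" "x \<in> V" "y \<in> V"
  shows "rank_in V l x < rank_in V l y \<longleftrightarrow> (x, y) \<in> l \<and> x \<noteq> y"
  using rank_in_le_iff[OF assms] rank_in_le_iff[OF assms(1,2,3,5,4)] linear_order_on_D(3)[OF assms(1), of x y] by auto

text \<open>The rigidifying points make the orientation of every incomparable pair of base points
  equivalent, through four forcing steps, to the orientation of the pair of corner points.\<close>

lemma framed_orientation:
  assumes R1: "linear_order_on UNIV R1" and R2: "linear_order_on UNIV R2"
    and l1: "linear_order_on (univ A) l1" and l2: "linear_order_on (univ A) l2" and A: "rel A = l1 \<inter> l2"
    and f: "framed R1 R2 n A f" and corner: "(f NW, f SE) \<in> l1"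
    and ij: "i < n" "j < n" "i \<noteq> j" "(i, j) \<in> R1" "(j, i) \<in> R2"
  shows "(f (Pt i), f (Pt j)) \<in> l1" "(f (Pt j), f (Pt i)) \<in> l2"
proof -
  have fA: "f x \<in> univ A" if "x \<in> labs n" for x using f that by (simp add: framed_def)
  have rel: "(f x, f y) \<in> l1 \<inter> l2 \<longleftrightarrow> cx R1 n x \<le> cx R1 n y \<and> cy R2 n x \<le> cy R2 n y"
    if "x \<in> labs n" "y \<in> labs n" for x y using f that by (simp add: framed_def A)
  have labs: "NW \<in> labs n" "SE \<in> labs n" "Pt i \<in> labs n" "Pt j \<in> labs n" "Le i \<in> labs n" "Ri i \<in> labs n"
    using ij by (auto simp: labs_def)
  have right: "(f a, f c) \<in> l1"
    if "(f a, f b) \<in> l1" "a \<in> labs n" "b \<in> labs n" "c \<in> labs n"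
      "\<not> (cx R1 n a \<le> cx R1 n b \<and> cy R2 n a \<le> cy R2 n b)" "\<not> (cx R1 n b \<le> cx R1 n a \<and> cy R2 n b \<le> cy R2 n a)"
      "\<not> (cx R1 n a \<le> cx R1 n c \<and> cy R2 n a \<le> cy R2 n c)" "\<not> (cx R1 n c \<le> cx R1 n a \<and> cy R2 n c \<le> cy R2 n a)"
      "cx R1 n b \<le> cx R1 n c \<and> cy R2 n b \<le> cy R2 n c \<or> cx R1 n c \<le> cx R1 n b \<and> cy R2 n c \<le> cy R2 n b"
    for a b c
    by (rule orientation_forcing[OF l1 l2 fA fA fA, of a b c])
      (use that in \<open>simp_all only: rel simp_thms\<close>)
  \<comment> \<open>Here the shared point comes last in \<open>l1\<close>, hence first in
    \<open>l2\<close>, where the forcing is applied.\<close>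
  have left: "(f c, f a) \<in> l1"
    if ba: "(f b, f a) \<in> l1" and abc: "a \<in> labs n" "b \<in> labs n" "c \<in> labs n"
      and inc: "\<not> (cx R1 n a \<le> cx R1 n b \<and> cy R2 n a \<le> cy R2 n b)" "\<not> (cx R1 n b \<le> cx R1 n a \<and> cy R2 n b \<le> cy R2 n a)"
      "\<not> (cx R1 n a \<le> cx R1 n c \<and> cy R2 n a \<le> cy R2 n c)" "\<not> (cx R1 n c \<le> cx R1 n a \<and> cy R2 n c \<le> cy R2 n a)"
      and cmp: "cx R1 n b \<le> cx R1 n c \<and> cy R2 n b \<le> cy R2 n c \<or> cx R1 n c \<le> cx R1 n b \<and> cy R2 n c \<le> cy R2 n b"
    for a b c
  proof -
    note i = inc[folded rel[OF abc(1,2)] rel[OF abc(2,1)] rel[OF abc(1,3)] rel[OF abc(3,1)]]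
    note c = cmp[folded rel[OF abc(2,3)] rel[OF abc(3,2)]]
    have "(f b, f a) \<notin> l2" using i(2) ba by blast
    then have "(f a, f b) \<in> l2" using linear_order_on_D(1)[OF l2 fA[OF abc(1)] fA[OF abc(2)]] by blast
    then have "(f a, f c) \<in> l2"
      using i c by (intro orientation_forcing[OF l2 l1 fA[OF abc(1)] fA[OF abc(2)] fA[OF abc(3)]]) (simp_all only: Int_commute[of l2 l1] simp_thms)
    then have "(f a, f c) \<notin> l1" using i(3) by blast
    then show ?thesis using linear_order_on_D(1)[OF l1 fA[OF abc(1)] fA[OF abc(3)]] by blast
  qed
  have bds: "1 \<le> rank_in {..<n} R1 k" "rank_in {..<n} R1 k \<le> n" "1 \<le> rank_in {..<n} R2 k" "rank_in {..<n} R2 k \<le> n" if "k < n" for k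
    using rank_in_bounds[OF R1, of "{..<n}" k] rank_in_bounds[OF R2, of "{..<n}" k] that by simp_all
  have r1: "rank_in {..<n} R1 i < rank_in {..<n} R1 j" using rank_in_less_iff[OF R1, of "{..<n}" i j] ij by simp
  have r2: "rank_in {..<n} R2 j + 1 \<le> rank_in {..<n} R2 i"
    using rank_in_less_iff[OF R2, of "{..<n}" j i] ij by (intro rank_in_less_imp) simp
  note b = bds[OF ij(1)] bds[OF ij(2)] r1 r2
  \<comment> \<open>Each step exchanges one end for a comparable point: \<open>SE\<close> lies below
    \<open>Ri i\<close>, \<open>Le i\<close> below \<open>NW\<close> and below \<open>Pt i\<close>,
    and \<open>Pt j\<close> below \<open>Ri i\<close>, being at least three levels under
    \<open>Pt i\<close>.\<close>
  have "(f NW, f (Ri i)) \<in> l1" by (rule right[OF corner]) (use labs b in simp_all)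
  then have "(f (Le i), f (Ri i)) \<in> l1" by (rule left) (use labs b in simp_all)
  then have "(f (Pt i), f (Ri i)) \<in> l1" by (rule left) (use labs b in simp_all)
  then show 1: "(f (Pt i), f (Pt j)) \<in> l1" by (rule right) (use labs b in simp_all)
  have "(f (Pt i), f (Pt j)) \<notin> l1 \<inter> l2" using rel[OF labs(3,4)] b by simp
  then have "(f (Pt i), f (Pt j)) \<notin> l2" using 1 by blast
  then show "(f (Pt j), f (Pt i)) \<in> l2"
    using linear_order_on_D(1)[OF l2 fA[OF labs(3)] fA[OF labs(4)]] by blast
qed

lemma framed_realizer_oriented:
  assumes R1: "linear_order_on UNIV R1" and R2: "linear_order_on UNIV R2"
    and l1: "linear_order_on (univ A) l1" and l2: "linear_order_on (univ A) l2" and A: "rel A = l1 \<inter> l2"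
    and f: "framed R1 R2 n A f" and corner: "(f NW, f SE) \<in> l1"
    and ij: "i < n" "j < n"
  shows "(i, j) \<in> R1 \<Longrightarrow> (f (Pt i), f (Pt j)) \<in> l1" "(i, j) \<in> R2 \<Longrightarrow> (f (Pt i), f (Pt j)) \<in> l2"
proof -
  have labs: "Pt i \<in> labs n" "Pt j \<in> labs n" using ij by (auto simp: labs_def)
  have fA: "f (Pt i) \<in> univ A" using f labs by (simp add: framed_def)
  have both: "(f (Pt i), f (Pt j)) \<in> l1 \<inter> l2" if "(i, j) \<in> R1" "(i, j) \<in> R2"
  proof -
    have "rank_in {..<n} R1 i \<le> rank_in {..<n} R1 j" "rank_in {..<n} R2 i \<le> rank_in {..<n} R2 j"
      using rank_in_le_iff[OF R1, of "{..<n}" i j] rank_in_le_iff[OF R2, of "{..<n}" i j] that ij by simp_all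
    then show ?thesis using f labs by (simp add: framed_def A[symmetric])
  qed
  show "(f (Pt i), f (Pt j)) \<in> l1" if "(i, j) \<in> R1"
  proof (cases "(i, j) \<in> R2")
    case True
    then show ?thesis using both that by blast
  next
    case False
    then have "(j, i) \<in> R2" "i \<noteq> j" using linear_order_on_D(1,4)[OF R2] by blast+
    then show ?thesis using framed_orientation(1)[OF R1 R2 l1 l2 A f corner ij _ that] by blast
  qed
  show "(f (Pt i), f (Pt j)) \<in> l2" if "(i, j) \<in> R2"
  proof (cases "(i, j) \<in> R1")
    case True
    then show ?thesis using both that by blast
  next
    case False
    then have "(j, i) \<in> R1" "j \<noteq> i" using linear_order_on_D(1,4)[OF R1] by blast+
    then show ?thesis using framed_orientation(2)[OF R1 R2 l1 l2 A f corner ij(2,1) _ _ that] by blast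
  qed
qed

text \<open>The corners are incomparable, so exactly one order of any realizer puts
  \<open>NW\<close> before \<open>SE\<close>; that one is taken as \<open>l1\<close>.\<close>

lemma framed_realizer:
  assumes R1: "linear_order_on UNIV R1" and R2: "linear_order_on UNIV R2"
    and A: "at_most_2_dim A" and f: "framed R1 R2 n A f"
  obtains l1 l2 where "linear_order_on (univ A) l1" "linear_order_on (univ A) l2" "rel A = l1 \<inter> l2"
    "\<And>i j. i < n \<Longrightarrow> j < n \<Longrightarrow> (i, j) \<in> R1 \<Longrightarrow> (f (Pt i), f (Pt j)) \<in> l1"
    "\<And>i j. i < n \<Longrightarrow> j < n \<Longrightarrow> (i, j) \<in> R2 \<Longrightarrow> (f (Pt i), f (Pt j)) \<in> l2"
proof -
  obtain l1 l2 where l: "linear_order_on (univ A) l1" "linear_order_on (univ A) l2" "rel A = l1 \<inter> l2"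
    using A by (rule at_most_2_dimE)
  have labs: "NW \<in> labs n" "SE \<in> labs n" by (auto simp: labs_def)
  have fA: "f NW \<in> univ A" "f SE \<in> univ A" using f labs by (auto simp: framed_def)
  show ?thesis
  proof (cases "(f NW, f SE) \<in> l1")
    case True
    show ?thesis
      by (rule that[OF l framed_realizer_oriented(1)[OF R1 R2 l f True] framed_realizer_oriented(2)[OF R1 R2 l f True]])
  next
    case False
    have l': "rel A = l2 \<inter> l1" using l(3) by blast
    have "(f SE, f NW) \<notin> l1 \<inter> l2" using f labs unfolding framed_def l(3)[symmetric] by simp
    moreover have "(f SE, f NW) \<in> l1" using False linear_order_on_D(1)[OF l(1) fA] by blast
    ultimately have "(f SE, f NW) \<notin> l2" by blast
    then have c: "(f NW, f SE) \<in> l2" using linear_order_on_D(1)[OF l(2) fA] by blast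
    show ?thesis
      by (rule that[OF l(2,1) l' framed_realizer_oriented(1)[OF R1 R2 l(2,1) l' f c] framed_realizer_oriented(2)[OF R1 R2 l(2,1) l' f c]])
  qed
qed

text \<open>A change of coordinates: it moves the ideal positions of the base points already placed
  to their actual ranks in \<open>V\<close>. The scale \<open>c\<close> is 1 horizontally and 3
  vertically.\<close>

lemma rank_transfer:
  fixes R :: "(nat \<times> nat) set"
  assumes R: "linear_order_on UNIV R" and l: "linear_order_on V l" and V: "finite V"
    and b: "\<And>i. i < n \<Longrightarrow> b i \<in> V" "inj_on b {..<n}"
    and mono: "\<And>i j. i < n \<Longrightarrow> j < n \<Longrightarrow> (i, j) \<in> R \<Longrightarrow> (b i, b j) \<in> l"
    and n: "n \<le> n'" and c: "c > 0"
  obtains h where "strict_mono h" "\<And>i. i < n \<Longrightarrow> h (c * rank_in {..<n'} R i) = rank_in V l (b i)"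
proof -
  define F where "F = (\<lambda>i. c * rank_in {..<n'} R i) ` {..<n}"
  have less: "rank_in V l (b i) < rank_in V l (b j)" if "i < n" "j < n" "rank_in {..<n'} R i < rank_in {..<n'} R j" for i j
  proof -
    have "i \<in> {..<n'}" "j \<in> {..<n'}" using less_le_trans[OF that(1) n] less_le_trans[OF that(2) n] by simp_all
    then have "(i, j) \<in> R \<and> i \<noteq> j"
      using rank_in_less_iff[OF R finite_lessThan subset_UNIV] that(3) by blast
    then have "(i, j) \<in> R" "i \<noteq> j" by blast+
    moreover from this have "b i \<noteq> b j" using b(2) that by (auto simp: inj_on_def)
    ultimately show ?thesis using rank_in_less_iff[OF l V order_refl b(1) b(1), of i j] mono that by simp
  qed
  have inj: "inj_on (\<lambda>i. c * rank_in {..<n'} R i) {..<n}"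
  proof (rule inj_onI)
    fix i j assume ij: "i \<in> {..<n}" "j \<in> {..<n}" "c * rank_in {..<n'} R i = c * rank_in {..<n'} R j"
    then have "rank_in {..<n'} R i \<le> rank_in {..<n'} R j" "rank_in {..<n'} R j \<le> rank_in {..<n'} R i" using c by simp_all
    moreover have "i \<in> {..<n'}" "j \<in> {..<n'}" using ij(1,2) n by (auto intro: less_le_trans)
    ultimately have "(i, j) \<in> R" "(j, i) \<in> R"
      using rank_in_le_iff[OF R finite_lessThan subset_UNIV] by blast+
    then show "i = j" by (rule linear_order_on_D(3)[OF R])
  qed
  define g where "g x = rank_in V l (b (inv_into {..<n} (\<lambda>i. c * rank_in {..<n'} R i) x))" for x
  have g: "g (c * rank_in {..<n'} R i) = rank_in V l (b i)" if "i < n" for i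
    unfolding g_def using inv_into_f_f[OF inj, of i] that by simp
  have "finite F" by (simp add: F_def)
  moreover have "g x < g y" if xy: "x \<in> F" "y \<in> F" "x < y" for x y
  proof -
    obtain i j where ij: "i < n" "x = c * rank_in {..<n'} R i" "j < n" "y = c * rank_in {..<n'} R j"
      using xy(1,2) by (auto simp: F_def)
    then have "rank_in {..<n'} R i < rank_in {..<n'} R j" using xy(3) c by simp
    then show ?thesis using less[OF ij(1,3)] g ij by simp
  qed
  ultimately obtain h where h: "strict_mono h" "\<And>x. x \<in> F \<Longrightarrow> h x = g x"
    using strict_mono_extension by blast
  show ?thesis
  proof (rule that[OF h(1)])
    fix i assume i: "i < n"
    then have "c * rank_in {..<n'} R i \<in> F" unfolding F_def by (intro imageI) simp
    from h(2)[OF this] g[OF i] show "h (c * rank_in {..<n'} R i) = rank_in V l (b i)" by (rule trans)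
  qed
qed

text \<open>\<open>A\<close> is drawn in the plane by its ranks in \<open>l1\<close> and
  \<open>l2\<close>, and a new frame for \<open>n'\<close> base points is drawn over it, distorted
  so that the old base points stay in place. The product order on the union is at most
  2-dimensional. Edge and corner points of an earlier frame remain as ordinary points.\<close>

lemma extend_framed:
  assumes R1: "linear_order_on UNIV R1" and R2: "linear_order_on UNIV R2"
    and l1: "linear_order_on (univ A) l1" and l2: "linear_order_on (univ A) l2" and A: "rel A = l1 \<inter> l2"
    and m: "univ A = {..<m}"
    and b: "\<And>i. i < n \<Longrightarrow> b i < m" "inj_on b {..<n}"
    and mono1: "\<And>i j. i < n \<Longrightarrow> j < n \<Longrightarrow> (i, j) \<in> R1 \<Longrightarrow> (b i, b j) \<in> l1"
    and mono2: "\<And>i j. i < n \<Longrightarrow> j < n \<Longrightarrow> (i, j) \<in> R2 \<Longrightarrow> (b i, b j) \<in> l2"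
    and n: "n \<le> n'"
  obtains m' A' f where "m \<le> m'" "at_most_2_dim A'" "univ A' = {..<m'}" "induced A' {..<m} = A"
    "framed R1 R2 n' A' f" "\<And>i. i < n \<Longrightarrow> f (Pt i) = b i"
proof -
  have bA: "b i \<in> univ A" if "i < n" for i using b(1) that m by simp
  have fin: "finite (univ A)" by (simp add: m)
  obtain h1 where h1: "strict_mono h1" "\<And>i. i < n \<Longrightarrow> h1 (1 * rank_in {..<n'} R1 i) = rank_in (univ A) l1 (b i)"
    using rank_transfer[OF R1 l1 fin bA b(2) mono1 n, of 1] by auto
  obtain h2 where h2: "strict_mono h2" "\<And>i. i < n \<Longrightarrow> h2 (3 * rank_in {..<n'} R2 i) = rank_in (univ A) l2 (b i)"
    using rank_transfer[OF R2 l2 fin bA b(2) mono2 n, of 3] by auto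
  define z0 where "z0 x = (rank_in (univ A) l1 x, rank_in (univ A) l2 x)" for x
  define \<zeta> where "\<zeta> x = (h1 (cx R1 n' x), h2 (cy R2 n' x))" for x
  have z0: "fst (z0 x) \<le> fst (z0 y) \<and> snd (z0 x) \<le> snd (z0 y) \<longleftrightarrow> (x, y) \<in> rel A" if "x < m" "y < m" for x y
    using rank_in_le_iff[OF l1 fin order_refl, of x y] rank_in_le_iff[OF l2 fin order_refl, of x y] that by (simp add: z0_def m A)
  have z0inj: "inj_on z0 {..<m}"
  proof (rule inj_onI)
    fix x y assume xy: "x \<in> {..<m}" "y \<in> {..<m}" "z0 x = z0 y"
    then have "(x, y) \<in> l1" "(y, x) \<in> l1" using z0[of x y] z0[of y x] A by auto
    then show "x = y" by (rule linear_order_on_D(3)[OF l1])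
  qed
  \<comment> \<open>Only frame positions not occupied by a point of \<open>A\<close> become new
    elements; coinciding positions are identified.\<close>
  define D where "D = \<zeta> ` labs n' - z0 ` {..<m}"
  have finD: "finite D" by (simp add: D_def labs_def)
  obtain g where g: "bij_betw g {0..<card D} D" using ex_bij_betw_nat_finite[OF finD] by blast
  define m' where "m' = m + card D"
  define z where "z i = (if i < m then z0 i else g (i - m))" for i
  have gD: "g (i - m) \<in> D" if "i < m'" "\<not> i < m" for i
    using bij_betwE[OF g] that by (auto simp: m'_def)
  have zinj: "inj_on z {..<m'}"
  proof (rule inj_onI)
    fix i j assume ij: "i \<in> {..<m'}" "j \<in> {..<m'}" "z i = z j"
    consider "i < m" "j < m" | "\<not> i < m" "\<not> j < m" | "i < m" "\<not> j < m" | "\<not> i < m" "j < m" by blast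
    then show "i = j"
    proof cases
      case 1
      then show ?thesis using ij z0inj by (auto simp: z_def inj_on_def)
    next
      case 2
      then have "g (i - m) = g (j - m)" using ij by (simp add: z_def)
      moreover have "i - m \<in> {0..<card D}" "j - m \<in> {0..<card D}" using ij 2 by (auto simp: m'_def)
      ultimately have "i - m = j - m" using bij_betw_imp_inj_on[OF g] by (meson inj_onD)
      then show ?thesis using 2 by simp
    next
      case 3
      then have "z0 i \<in> D" using ij gD[of j] by (simp add: z_def)
      then show ?thesis using 3(1) by (auto simp: D_def)
    next
      case 4
      then have "z0 j \<in> D" using ij gD[of i] by (simp add: z_def)
      then show ?thesis using 4(2) by (auto simp: D_def)
    qed
  qed
  have zsurj: "\<exists>i<m'. z i = \<zeta> x" if "x \<in> labs n'" for x
  proof (cases "\<zeta> x \<in> D")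
    case True
    then have "\<zeta> x \<in> g ` {0..<card D}" using bij_betw_imp_surj_on[OF g] by simp
    then obtain k where "k < card D" "\<zeta> x = g k" by auto
    then show ?thesis by (intro exI[of _ "m + k"]) (auto simp: z_def m'_def)
  next
    case False
    then have "\<zeta> x \<in> z0 ` {..<m}" using imageI[OF that, of \<zeta>] by (simp add: D_def)
    then obtain i where "i < m" "\<zeta> x = z0 i" by auto
    then show ?thesis by (intro exI[of _ i]) (auto simp: z_def m'_def)
  qed
  define A' where "A' = Binstr {..<m'} {(x, y). x \<in> {..<m'} \<and> y \<in> {..<m'} \<and> fst (z x) \<le> fst (z y) \<and> snd (z x) \<le> snd (z y)}"
  define f where "f x = inv_into {..<m'} z (\<zeta> x)" for x
  have f: "f x < m'" "z (f x) = \<zeta> x" if "x \<in> labs n'" for x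
  proof -
    from zsurj[OF that] obtain i where "i < m'" "z i = \<zeta> x" by blast
    then have "\<zeta> x \<in> z ` {..<m'}" by (metis imageI lessThan_iff)
    then show "f x < m'" "z (f x) = \<zeta> x"
      unfolding f_def using inv_into_into[of "\<zeta> x" z "{..<m'}"] by (simp_all add: f_inv_into_f)
  qed
  show ?thesis
  proof (rule that[of m' A' f])
    show "m \<le> m'" by (simp add: m'_def)
    show "univ A' = {..<m'}" by (simp add: A'_def)
    show "at_most_2_dim A'"
      unfolding A'_def
    proof (rule at_most_2_dim_product_order)
      fix x y assume "x \<in> {..<m'}" "y \<in> {..<m'}" "fst (z x) = fst (z y)" "snd (z x) = snd (z y)"
      then show "x = y" using inj_onD[OF zinj, of x y] by (simp add: prod_eq_iff)
    qed
    have "rel A' \<inter> {..<m} \<times> {..<m} = rel A"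
    proof -
      have "rel A \<subseteq> {..<m} \<times> {..<m}" using linear_order_on_D(5)[OF l1] A m by blast
      moreover have "(x, y) \<in> rel A' \<longleftrightarrow> (x, y) \<in> rel A" if "x < m" "y < m" for x y
        using z0[OF that] that by (simp add: A'_def z_def m'_def)
      ultimately show ?thesis by blast
    qed
    then show "induced A' {..<m} = A" using m by (cases A) (simp add: induced_def)
    show "framed R1 R2 n' A' f"
      unfolding framed_def
    proof (intro conjI ballI)
      show "f x \<in> univ A'" if "x \<in> labs n'" for x using f(1)[OF that] by (simp add: A'_def)
      show "(f x, f y) \<in> rel A' \<longleftrightarrow> cx R1 n' x \<le> cx R1 n' y \<and> cy R2 n' x \<le> cy R2 n' y"
        if "x \<in> labs n'" "y \<in> labs n'" for x y
        using f[OF that(1)] f[OF that(2)] strict_mono_less_eq[OF h1(1)] strict_mono_less_eq[OF h2(1)]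
        by (simp add: A'_def \<zeta>_def)
    qed
    show "f (Pt i) = b i" if "i < n" for i
    proof -
      have "z (b i) = \<zeta> (Pt i)" using b(1)[OF that] h1(2)[OF that] h2(2)[OF that] by (simp add: z_def z0_def \<zeta>_def)
      moreover have "b i < m'" using b(1)[OF that] by (simp add: m'_def)
      ultimately show ?thesis unfolding f_def using inv_into_f_f[OF zinj, of "b i"] by simp
    qed
  qed
qed

section \<open>Embedding the words into the generic order\<close>

lemma framed_induced:
  assumes f: "framed R1 R2 n A f" and A: "univ A = {..<m}" "induced A' {..<m} = A" "univ A' = {..<m'}" "m \<le> m'"
  shows "framed R1 R2 n A' f"
proof -
  have "f x < m" if "x \<in> labs n" for x using f that A(1) by (auto simp: framed_def)
  moreover have "(x, y) \<in> rel A \<longleftrightarrow> (x, y) \<in> rel A'" if "x < m" "y < m" for x y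
    using that by (auto simp: A(2)[symmetric] induced_def)
  ultimately show ?thesis using f A(3,4) by (force simp: framed_def)
qed

lemma framed_base:
  assumes R1: "linear_order_on UNIV R1" and R2: "linear_order_on UNIV R2"
    and f: "framed R1 R2 n A f" and ij: "i < n" "j < n"
  shows "(f (Pt i), f (Pt j)) \<in> rel A \<longleftrightarrow> (i, j) \<in> R1 \<inter> R2"
proof -
  have "Pt i \<in> labs n" "Pt j \<in> labs n" using ij by (auto simp: labs_def)
  then have "(f (Pt i), f (Pt j)) \<in> rel A \<longleftrightarrow>
      rank_in {..<n} R1 i \<le> rank_in {..<n} R1 j \<and> rank_in {..<n} R2 i \<le> rank_in {..<n} R2 j"
    using f by (simp add: framed_def)
  then show ?thesis
    using rank_in_le_iff[OF R1, of "{..<n}" i j] rank_in_le_iff[OF R2, of "{..<n}" i j] ij by simp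
qed

lemma framed_inj:
  assumes R1: "linear_order_on UNIV R1" and R2: "linear_order_on UNIV R2"
    and f: "framed R1 R2 n A f"
  shows "inj_on (\<lambda>i. f (Pt i)) {..<n}"
proof (rule inj_onI)
  fix i j assume ij: "i \<in> {..<n}" "j \<in> {..<n}" "f (Pt i) = f (Pt j)"
  have "(f (Pt i), f (Pt i)) \<in> rel A" using framed_base[OF R1 R2 f, of i i] ij linear_order_on_D(4)[OF R1] linear_order_on_D(4)[OF R2] by simp
  then have "(i, j) \<in> R1" "(j, i) \<in> R1"
    using framed_base[OF R1 R2 f, of i j] framed_base[OF R1 R2 f, of j i] ij by auto
  then show "i = j" by (rule linear_order_on_D(3)[OF R1])
qed

text \<open>A Baire category construction that alternates between avoiding \<open>N n\<close> and
  adding the base point \<open>n\<close>. The union \<open>M\<close> of the approximations avoids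
  all \<open>N n\<close>, and the base points form a copy of the given order in
  \<open>M\<close>.\<close>

lemma embeds_outside_meager:
  fixes R1 R2 :: "(nat \<times> nat) set" and N :: "nat \<Rightarrow> nat binstr set"
  assumes R1: "linear_order_on UNIV R1" and R2: "linear_order_on UNIV R2"
    and K: "K2 \<subseteq> Age (Binstr UNIV (R1 \<inter> R2))"
    and N: "\<And>n. nowhere_dense_in (structure_space K2) (N n)"
  shows "\<exists>M\<in>topspace (structure_space K2). (\<forall>n. M \<notin> N n) \<and> Emb (Binstr UNIV (R1 \<inter> R2)) M \<noteq> {}"
proof -
  define I where "I n s \<longleftrightarrow> (case s of (m, A, f) \<Rightarrow> univ A = {..<m} \<and> at_most_2_dim A \<and> framed R1 R2 n A f)" for n s
  define J where "J n s s' \<longleftrightarrow> (case s of (m, A, f) \<Rightarrow> case s' of (m', A', f') \<Rightarrow> m \<le> m' \<and> induced A' {..<m} = A \<and>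
     (\<forall>M\<in>topspace (structure_space K2). induced M {..<m'} = A' \<longrightarrow> M \<notin> N n) \<and> (\<forall>i<n. f' (Pt i) = f (Pt i)))"
    for n :: nat and s s' :: "nat \<times> nat binstr \<times> (lab \<Rightarrow> nat)"
  have "\<exists>S. \<forall>n. I n (S n) \<and> J n (S n) (S (Suc n))"
  proof (rule dependent_nat_choice)
    obtain m' A' f where "at_most_2_dim A'" "univ A' = {..<m'}" "framed R1 R2 0 A' f"
      by (rule extend_framed[OF R1 R2, of "Binstr {} {}" "{}" "{}" 0 0 "\<lambda>_. 0" 0]) auto
    then have "I 0 (m', A', f)" by (simp add: I_def)
    then show "\<exists>s. I 0 s" by blast
  next
    fix s n assume "I n s"
    then obtain m A f where s: "s = (m, A, f)" "univ A = {..<m}" "at_most_2_dim A" "framed R1 R2 n A f"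
      by (cases s) (auto simp: I_def)
    obtain m1 A1 where 1: "m \<le> m1" "at_most_2_dim A1" "univ A1 = {..<m1}" "induced A1 {..<m} = A"
      "\<And>M. M \<in> topspace (structure_space K2) \<Longrightarrow> induced M {..<m1} = A1 \<Longrightarrow> M \<notin> N n"
      using avoid_nowhere_dense[OF N s(3,2)] by metis
    have f1: "framed R1 R2 n A1 f" by (rule framed_induced[OF s(4,2) 1(4,3,1)])
    \<comment> \<open>The points of \<open>A1\<close> beyond \<open>A\<close> are uncontrolled, but
      the frame still yields a realizer that agrees with \<open>R1\<close> and \<open>R2\<close> on
      the base points.\<close>
    obtain l1 l2 where l: "linear_order_on (univ A1) l1" "linear_order_on (univ A1) l2" "rel A1 = l1 \<inter> l2"
      "\<And>i j. i < n \<Longrightarrow> j < n \<Longrightarrow> (i, j) \<in> R1 \<Longrightarrow> (f (Pt i), f (Pt j)) \<in> l1"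
      "\<And>i j. i < n \<Longrightarrow> j < n \<Longrightarrow> (i, j) \<in> R2 \<Longrightarrow> (f (Pt i), f (Pt j)) \<in> l2"
      using framed_realizer[OF R1 R2 1(2) f1] by metis
    have b: "f (Pt i) < m1" if "i < n" for i
    proof -
      have "f (Pt i) \<in> univ A1" using f1 that by (auto simp: framed_def labs_def)
      then show ?thesis by (simp add: 1(3))
    qed
    obtain m' A' f' where 2: "m1 \<le> m'" "at_most_2_dim A'" "univ A' = {..<m'}" "induced A' {..<m1} = A1"
      "framed R1 R2 (Suc n) A' f'" "\<And>i. i < n \<Longrightarrow> f' (Pt i) = f (Pt i)"
      using extend_framed[OF R1 R2 l(1-3) 1(3) b framed_inj[OF R1 R2 f1] l(4,5), of "Suc n"] by auto
    have "I (Suc n) (m', A', f')" using 2 by (simp add: I_def)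
    moreover have "J n s (m', A', f')"
      unfolding J_def s(1) prod.case
    proof (intro conjI ballI impI allI)
      show "m \<le> m'" using 1(1) 2(1) by simp
      show "induced A' {..<m} = A" using induced_induced[OF 1(1), of A'] 1(4) 2(4) by simp
      show "M \<notin> N n" if "M \<in> topspace (structure_space K2)" "induced M {..<m'} = A'" for M
        using 1(5)[OF that(1)] induced_induced[OF 2(1), of M] that(2) 2(4) by simp
      show "f' (Pt i) = f (Pt i)" if "i < n" for i using 2(6) that .
    qed
    ultimately show "\<exists>s'. I (Suc n) s' \<and> J n s s'" by blast
  qed
  then obtain S where S: "\<And>n. I n (S n)" "\<And>n. J n (S n) (S (Suc n))" by blast
  define m where "m n = fst (S n)" for n
  define A where "A n = fst (snd (S n))" for n
  define f where "f n = snd (snd (S n))" for n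
  have univA: "univ (A n) = {..<m n}" and dimA: "at_most_2_dim (A n)" and fr: "framed R1 R2 n (A n) (f n)" for n
    using S(1)[of n] by (auto simp: I_def m_def A_def f_def split: prod.splits)
  have mSuc: "m n \<le> m (Suc n)" and ASuc: "induced (A (Suc n)) {..<m n} = A n"
    and avoid: "\<And>M. M \<in> topspace (structure_space K2) \<Longrightarrow> induced M {..<m (Suc n)} = A (Suc n) \<Longrightarrow> M \<notin> N n"
    and fSuc: "\<And>i. i < n \<Longrightarrow> f (Suc n) (Pt i) = f n (Pt i)" for n
    using S(2)[of n] by (auto simp: J_def m_def A_def f_def split: prod.splits)
  have mmono: "m n \<le> m (n + d)" for n d
    by (induction d) (auto intro: order_trans mSuc)
  have Amono: "induced (A (n + d)) {..<m n} = A n" for n d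
  proof (induction d)
    case 0
    have "rel (A n) \<subseteq> {..<m n} \<times> {..<m n}" using at_most_2_dim_wf[OF dimA] univA by (simp add: wf_binstr_def)
    then show ?case using univA[of n] by (cases "A n") (auto simp: induced_def)
  next
    case (Suc d)
    have "induced (A (n + Suc d)) {..<m n} = induced (induced (A (Suc (n + d))) {..<m (n + d)}) {..<m n}"
      using induced_induced[OF mmono] by simp
    then show ?case by (simp add: ASuc Suc.IH)
  qed
  have fmono: "f (Suc i + d) (Pt i) = f (Suc i) (Pt i)" for i d
    by (induction d) (auto simp: fSuc)
  \<comment> \<open>The \<open>n\<close> base points are distinct, so the universes of the
    approximations exhaust the natural numbers.\<close>
  have nm: "n \<le> m n" for n
  proof -
    have "(\<lambda>i. f n (Pt i)) ` {..<n} \<subseteq> {..<m n}"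
      using fr[of n] univA[of n] by (auto simp: framed_def labs_def)
    then have "card {..<n} \<le> card {..<m n}" by (rule card_inj_on_le[OF framed_inj[OF R1 R2 fr]]) simp
    then show ?thesis by simp
  qed
  define M where "M = Binstr (UNIV :: nat set) (\<Union>n. rel (A n))"
  have relM: "(x, y) \<in> rel M \<longleftrightarrow> (x, y) \<in> rel (A n)" if xy: "x < m n" "y < m n" for x y n
  proof
    assume "(x, y) \<in> rel M"
    then obtain k where k: "(x, y) \<in> rel (A k)" by (auto simp: M_def)
    show "(x, y) \<in> rel (A n)"
    proof (cases "k \<le> n")
      case True
      then have "A k = induced (A n) {..<m k}" using Amono[of k "n - k"] by simp
      then show ?thesis using k by (simp add: induced_def)
    next
      case False
      then have "A n = induced (A k) {..<m n}" using Amono[of n "k - n"] by simp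
      then show ?thesis using k xy by (simp add: induced_def)
    qed
  qed (auto simp: M_def)
  have indM: "induced M {..<m n} = A n" for n
  proof -
    have "rel (A n) \<subseteq> {..<m n} \<times> {..<m n}" using at_most_2_dim_wf[OF dimA] univA by (simp add: wf_binstr_def)
    then have "rel M \<inter> {..<m n} \<times> {..<m n} = rel (A n)" using relM[of _ n] by blast
    then show ?thesis using univA[of n] by (cases "A n") (simp add: induced_def)
  qed
  define T where "T = Binstr (UNIV :: nat set) (R1 \<inter> R2)"
  define F where "F i = f (Suc i) (Pt i)" for i
  have F: "F i = f n (Pt i)" if "i < n" for i n
    using fmono[of i "n - Suc i"] that by (simp add: F_def)
  have Frel: "(F i, F j) \<in> rel M \<longleftrightarrow> (i, j) \<in> rel T" for i j
  proof -
    define n where "n = Suc (max i j)"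
    have ij: "i < n" "j < n" by (auto simp: n_def)
    have "F k < m n" if "k < n" for k
    proof -
      have "f n (Pt k) \<in> univ (A n)" using fr[of n] that by (auto simp: framed_def labs_def)
      then show ?thesis using F[OF that] univA by simp
    qed
    then have "(F i, F j) \<in> rel M \<longleftrightarrow> (F i, F j) \<in> rel (A n)" using relM ij by blast
    also have "\<dots> \<longleftrightarrow> (i, j) \<in> R1 \<inter> R2" using framed_base[OF R1 R2 fr ij] F[OF ij(1)] F[OF ij(2)] by simp
    finally show ?thesis by (simp add: T_def)
  qed
  have "inj F"
  proof (rule injI)
    fix i j assume "F i = F j"
    then have "(i, j) \<in> rel T" "(j, i) \<in> rel T"
      using Frel[of i i] Frel[of i j] Frel[of j i] linear_order_on_D(4)[OF R1, of i] linear_order_on_D(4)[OF R2, of i]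
      by (auto simp: T_def)
    then show "i = j" using linear_order_on_D(3)[OF R1] by (auto simp: T_def)
  qed
  then have FE: "restrict F (univ T) \<in> Emb T M"
    by (intro EmbI) (simp_all only: Frel, simp_all add: T_def M_def)
  have "Age M = K2"
  proof (intro equalityI subsetI)
    fix P assume P: "P \<in> Age M"
    then obtain g where g: "g \<in> Emb P M" and fin: "finite (univ P)" and wf: "wf_binstr P" by (auto simp: Age_def)
    obtain n where n: "\<forall>x\<in>g ` univ P. x < n" using fin finite_nat_set_iff_bounded[of "g ` univ P"] by auto
    have gm: "g x < m n" if "x \<in> univ P" for x using n nm[of n] that by force
    have "(g x, g y) \<in> rel (A n) \<longleftrightarrow> (x, y) \<in> rel P" if "x \<in> univ P" "y \<in> univ P" for x y
      using relM[OF gm[OF that(1)] gm[OF that(2)]] Emb_D(3)[OF g that] by (rule HOL.trans[OF sym])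
    then have "restrict g (univ P) \<in> Emb P (A n)"
      by (intro EmbI) (use gm Emb_D(2)[OF g] in \<open>simp_all add: univA\<close>)
    then show "P \<in> K2" using at_most_2_dim_pullback[OF _ dimA wf] fin by (auto simp: K2_def)
  next
    fix P assume "P \<in> K2"
    then have "P \<in> Age T" using K by (auto simp: T_def)
    then show "P \<in> Age M" using Emb_compose[OF _ FE] by (fastforce simp: Age_def)
  qed
  moreover have "wf_binstr M" "univ M = UNIV" by (simp_all add: M_def wf_binstr_def)
  ultimately have M: "M \<in> topspace (structure_space K2)" by (simp add: topspace_structure_space)
  show ?thesis
    using M avoid[OF M indM] FE unfolding T_def by blast
qed

lemma words_embed_generic:
  assumes "weak_Fraisse_limit K2 \<Omega>"
  shows "Emb words \<Omega> \<noteq> {}"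
proof -
  define X where "X = structure_space K2"
  define C where "C = {M \<in> topspace X. isomorphic M \<Omega>}"
  obtain \<N> where \<N>: "countable \<N>" "\<And>N. N \<in> \<N> \<Longrightarrow> nowhere_dense_in X N" "topspace X - C = \<Union>\<N>"
    using assms unfolding weak_Fraisse_limit_def comeager_in_def meager_in_def X_def C_def by blast
  \<comment> \<open>Adding the empty set makes the family nonempty, so that it can be enumerated as
    a sequence.\<close>
  define N where "N = from_nat_into (insert {} \<N>)"
  have "nowhere_dense_in X {}" by (simp add: nowhere_dense_in_def)
  then have N: "nowhere_dense_in X (N n)" for n
    using from_nat_into[of "insert {} \<N>" n] \<N>(2) unfolding N_def by auto
  have "range N = insert {} \<N>" unfolding N_def using \<N>(1) by (intro range_from_nat_into) auto
  then have cover: "topspace X - C \<subseteq> (\<Union>n. N n)" using \<N>(3) by auto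
  have "bij_betw (from_nat_into (univ words)) UNIV (univ words)"
    by (rule bij_betw_from_nat_into) (auto simp: infinite_words)
  note T = Age_words_copy[OF this]
  define T where "T = Binstr UNIV {(i, j). (from_nat_into (univ words) i, from_nat_into (univ words) j) \<in> rel words}"
  obtain R1 R2 where R: "linear_order_on (univ T) R1" "linear_order_on (univ T) R2" "rel T = R1 \<inter> R2"
    using T(2) unfolding T_def[symmetric] by (rule at_most_2_dimE)
  have uT: "univ T = UNIV" by (simp add: T_def)
  have TR: "Binstr UNIV (R1 \<inter> R2) = T" using R(3) uT by (cases T) simp
  have "Age T = K2" using T(1) unfolding T_def[symmetric] by (simp add: topspace_structure_space)
  then have K: "K2 \<subseteq> Age (Binstr UNIV (R1 \<inter> R2))" by (simp add: TR)
  obtain M where M: "M \<in> topspace (structure_space K2)" "\<And>n. M \<notin> N n" "Emb (Binstr UNIV (R1 \<inter> R2)) M \<noteq> {}"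
    using embeds_outside_meager[OF R(1)[unfolded uT] R(2)[unfolded uT] K, of N] N unfolding X_def by blast
  \<comment> \<open>Lying outside all \<open>N n\<close>, the structure \<open>M\<close> is
    isomorphic to \<open>\<Omega>\<close> and carries its copy of the words there.\<close>
  have "M \<in> C" using M(1,2) cover unfolding X_def by blast
  then obtain h where h: "h \<in> Emb M \<Omega>" by (auto simp: C_def isomorphic_def)
  obtain g where g: "g \<in> Emb T M" using M(3) unfolding TR by blast
  obtain e where e: "e \<in> Emb words T" using T(3) unfolding T_def[symmetric] by blast
  show ?thesis using Emb_compose[OF Emb_compose[OF e g] h] by blast
qed

theorem theorem6p4:
  fixes \<Omega> :: "nat binstr"
  assumes "generic_2_dim_partial_order \<Omega>"
  shows "finite_big_ramsey_degrees \<Omega>"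
proof -
  have \<Omega>: "weak_Fraisse_limit K2 \<Omega>" using assms by (simp add: generic_2_dim_partial_order_def)
  then have "Emb \<Omega> words \<noteq> {}" by (intro generic_embeds_words) (simp add: weak_Fraisse_limit_def)
  moreover have "Emb words \<Omega> \<noteq> {}" by (rule words_embed_generic[OF \<Omega>])
  ultimately show ?thesis using finite_big_ramsey_degrees_if_bi_embeddable_words by blast
qed

end
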